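(* Let $p$ be a prime, let $K_1$ and $K_2$ be complete discrete valued fields of mixed characteristic $(0,p)$ with perfect residue fields, and let $n,m\ge 1$ be integers. Suppose $K_1$ is tamely ramified. Then any homomorphism over $p$ from $\mathcal H_n(K_1)$ to $\mathcal H_m(K_2)$ is induced from a unique homomorphism from $K_1$ to $K_2$; that is, for every homomorphism $f:\mathcal H_n(K_1)\to\mathcal H_m(K_2)$ over $p$ there is a unique homomorphism of valued fields $g:K_1\to K_2$ with $f([x]_n)=[g(x)]_m$ for all $x\in K_1$. From this it follows that there is a one-to-one correspondence between $\mathrm{Hom}_{\mathbb Z}(\mathcal H_n(K_1),\mathcal H_m(K_2))$, the set of homomorphisms over $p$ from $\mathcal H_n(K_1)$ to $\mathcal H_m(K_2)$, and $\mathrm{Hom}(K_1,K_2)$, the set of homomorphisms of valued fields from $K_1$ to $K_2$.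
   Context: Let $(K,\nu)$ be a discrete valued field of mixed characteristic $(0,p)$ with valuation ring $R$ and maximal ideal $\mathfrak m$. The valuation is normalized so that $\nu(p)=1$. The absolute ramification index is the integer $e$ with $pR=\mathfrak m^e$, and $K$ is (absolutely) tamely ramified if $p\nmid e$. For $n\ge1$ the $n$-th valued hyperfield is $\mathcal H_n(K)=K/(1+\mathfrak m^n)$, the set of classes $[x]_n=x(1+\mathfrak m^n)$, $x\in K$, with multiplication $[x]_n[y]_n=[xy]_n$, multivalued addition $[x]_n+[y]_n=\{[x'+y']_n: x'\in[x]_n,\ y'\in[y]_n\}$, and valuation $\nu([x]_n)=\nu(x)$. A homomorphism $f:\mathcal H_n(K_1)\to\mathcal H_m(K_2)$ is a map with $f(0)=0$, $f(1)=1$, $f(\alpha\beta)=f(\alpha)f(\beta)$, $f(\alpha+\beta)\subseteq f(\alpha)+f(\beta)$, and $\nu_1(\alpha)\le\nu_1(\beta)\Leftrightarrow \nu_2(f(\alpha))\le\nu_2(f(\beta))$ for all $\alpha,\beta$. It is over $p$ if $f([p]_n)=[p]_m$. A homomorphism of valued fields $g:K_1\to K_2$ is a field homomorphism with $\nu_1(a)<\nu_1(b)\Leftrightarrow\nu_2(g(a))<\nu_2(g(b))$ for all $a,b\in K_1$.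
   Formalization: The one-to-one correspondence fails for some n, m (K1=K2=Q_p, n=1, m=2: Hom_Z is empty, Hom is not); it is stated onto those g that induce a map of hyperfields, and onto all of Hom(K1,K2) exactly when m·e1 ≤ n·e2 or Hom(K1,K2) is empty. *)

theory Defs
  imports "HOL-Library.Extended_Real" "HOL-Library.FuncSet" "HOL-Algebra.Algebra"
begin

text \<open>
  Valuations are written additively with values in the extended reals. The constant \<open>c\<close> in
  \<open>discrete\<close> is the valuation of a uniformizer. Characteristic 0 is the sort constraint
  \<open>field_char_0\<close>; residue characteristic \<open>p\<close> and the normalization are both contained in
  \<open>v p = 1\<close> for the prime \<open>p\<close>.
\<close>

locale mixed_char_discrete_valuation =
  fixes v :: "'a::field_char_0 \<Rightarrow> ereal" and p :: nat
  assumes prime_p: "Factorial_Ring.prime p"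
    and eq_infinity_iff: "v x = \<infinity> \<longleftrightarrow> x = 0"
    and mult: "v (x * y) = v x + v y"
    and add: "min (v x) (v y) \<le> v (x + y)"
    and discrete: "\<exists>c>0. v ` (UNIV - {0}) = range (\<lambda>k::int. ereal (c * real_of_int k))"
    and normalized: "v (of_nat p) = 1"

definition valuation_ring :: "('a::field_char_0 \<Rightarrow> ereal) \<Rightarrow> 'a ring" where
  "valuation_ring v =
     \<lparr>carrier = {x. 0 \<le> v x}, monoid.mult = (*), one = 1, ring.zero = 0, add = (+)\<rparr>"

definition maximal_ideal :: "('a::field_char_0 \<Rightarrow> ereal) \<Rightarrow> 'a set" where
  "maximal_ideal v = {x. 0 < v x}"

definition maximal_ideal_power :: "('a::field_char_0 \<Rightarrow> ereal) \<Rightarrow> nat \<Rightarrow> 'a set" where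
  "maximal_ideal_power v n = maximal_ideal v [^]\<^bsub>ideals_set (valuation_ring v)\<^esub> n"

definition residue_field :: "('a::field_char_0 \<Rightarrow> ereal) \<Rightarrow> 'a set ring" where
  "residue_field v = valuation_ring v Quot maximal_ideal v"

text \<open>The premise on \<open>q\<close> says that \<open>q\<close> is the characteristic of \<open>F\<close>; it never holds
  in characteristic 0.\<close>

definition perfect_field :: "('a, 'b) ring_scheme \<Rightarrow> bool" where
  "perfect_field F \<longleftrightarrow> field F \<and>
     (\<forall>q::nat. Factorial_Ring.prime q \<and> [q] \<cdot>\<^bsub>F\<^esub> \<one>\<^bsub>F\<^esub> = \<zero>\<^bsub>F\<^esub> \<longrightarrow>
        (\<forall>x\<in>carrier F. \<exists>y\<in>carrier F. y [^]\<^bsub>F\<^esub> q = x))"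

definition valuation_complete :: "('a::field_char_0 \<Rightarrow> ereal) \<Rightarrow> bool" where
  "valuation_complete v \<longleftrightarrow>
     (\<forall>s::nat \<Rightarrow> 'a.
        (\<forall>C::real. \<exists>N. \<forall>i\<ge>N. \<forall>j\<ge>N. ereal C \<le> v (s i - s j)) \<longrightarrow>
        (\<exists>l. \<forall>C::real. \<exists>N. \<forall>i\<ge>N. ereal C \<le> v (s i - l)))"

definition ramification_index :: "('a::field_char_0 \<Rightarrow> ereal) \<Rightarrow> nat \<Rightarrow> nat" where
  "ramification_index v p =
     (THE e. PIdl\<^bsub>valuation_ring v\<^esub> (of_nat p) = maximal_ideal_power v e)"

definition tamely_ramified :: "('a::field_char_0 \<Rightarrow> ereal) \<Rightarrow> nat \<Rightarrow> bool" where
  "tamely_ramified v p \<longleftrightarrow> \<not> p dvd ramification_index v p"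

definition hclass :: "('a::field_char_0 \<Rightarrow> ereal) \<Rightarrow> nat \<Rightarrow> 'a \<Rightarrow> 'a set" where
  "hclass v n x = {x * (1 + a) | a. a \<in> maximal_ideal_power v n}"

definition hyperfield :: "('a::field_char_0 \<Rightarrow> ereal) \<Rightarrow> nat \<Rightarrow> 'a set set" where
  "hyperfield v n = range (hclass v n)"

text \<open>Multiplication and valuation are defined through representatives and are meaningful on
  \<open>hyperfield v n\<close>, \<open>n \<ge> 1\<close>, where the result does not depend on the choice.\<close>

definition hmult :: "('a::field_char_0 \<Rightarrow> ereal) \<Rightarrow> nat \<Rightarrow> 'a set \<Rightarrow> 'a set \<Rightarrow> 'a set" where
  "hmult v n \<alpha> \<beta> =
     (THE \<gamma>. \<exists>x y. \<alpha> = hclass v n x \<and> \<beta> = hclass v n y \<and> \<gamma> = hclass v n (x * y))"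

definition hadd :: "('a::field_char_0 \<Rightarrow> ereal) \<Rightarrow> nat \<Rightarrow> 'a set \<Rightarrow> 'a set \<Rightarrow> 'a set set" where
  "hadd v n \<alpha> \<beta> = {hclass v n (x + y) | x y. x \<in> \<alpha> \<and> y \<in> \<beta>}"

definition hval :: "('a::field_char_0 \<Rightarrow> ereal) \<Rightarrow> nat \<Rightarrow> 'a set \<Rightarrow> ereal" where
  "hval v n \<alpha> = (THE w. \<exists>x. \<alpha> = hclass v n x \<and> w = v x)"

text \<open>Maps are taken extensional, so that equality of functions is equality on
  \<open>hyperfield v n\<close>.\<close>

definition hyperfield_hom ::
  "('a::field_char_0 \<Rightarrow> ereal) \<Rightarrow> nat \<Rightarrow> ('b::field_char_0 \<Rightarrow> ereal) \<Rightarrow> nat \<Rightarrow> ('a set \<Rightarrow> 'b set) set"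
  where
  "hyperfield_hom v n w m =
     {f \<in> hyperfield v n \<rightarrow>\<^sub>E hyperfield w m.
        f (hclass v n 0) = hclass w m 0 \<and>
        f (hclass v n 1) = hclass w m 1 \<and>
        (\<forall>\<alpha>\<in>hyperfield v n. \<forall>\<beta>\<in>hyperfield v n.
           f (hmult v n \<alpha> \<beta>) = hmult w m (f \<alpha>) (f \<beta>) \<and>
           f ` hadd v n \<alpha> \<beta> \<subseteq> hadd w m (f \<alpha>) (f \<beta>) \<and>
           (hval v n \<alpha> \<le> hval v n \<beta> \<longleftrightarrow> hval w m (f \<alpha>) \<le> hval w m (f \<beta>)))}"

definition hyperfield_hom_over ::
  "nat \<Rightarrow> ('a::field_char_0 \<Rightarrow> ereal) \<Rightarrow> nat \<Rightarrow> ('b::field_char_0 \<Rightarrow> ereal) \<Rightarrow> nat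
     \<Rightarrow> ('a set \<Rightarrow> 'b set) set"
  where
  "hyperfield_hom_over p v n w m =
     {f \<in> hyperfield_hom v n w m. f (hclass v n (of_nat p)) = hclass w m (of_nat p)}"

definition valued_field_hom ::
  "('a::field_char_0 \<Rightarrow> ereal) \<Rightarrow> ('b::field_char_0 \<Rightarrow> ereal) \<Rightarrow> ('a \<Rightarrow> 'b) set" where
  "valued_field_hom v w =
     {g. g 1 = 1 \<and> (\<forall>x y. g (x + y) = g x + g y) \<and> (\<forall>x y. g (x * y) = g x * g y) \<and>
         (\<forall>a b. v a < v b \<longleftrightarrow> w (g a) < w (g b))}"

definition induced_from ::
  "('a::field_char_0 \<Rightarrow> ereal) \<Rightarrow> nat \<Rightarrow> ('b::field_char_0 \<Rightarrow> ereal) \<Rightarrow> nat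
     \<Rightarrow> ('a set \<Rightarrow> 'b set) \<Rightarrow> ('a \<Rightarrow> 'b) \<Rightarrow> bool"
  where
  "induced_from v n w m f g \<longleftrightarrow> (\<forall>x. f (hclass v n x) = hclass w m (g x))"

text \<open>\<open>g\<close> descends to a well-defined map between the hyperfields. This can fail when \<open>m\<close> is
  large compared with \<open>n\<close>: the identity of the p-adic numbers does not descend
  for \<open>n = 1\<close>, \<open>m = 2\<close>.\<close>

definition descends ::
  "('a::field_char_0 \<Rightarrow> ereal) \<Rightarrow> nat \<Rightarrow> ('b::field_char_0 \<Rightarrow> ereal) \<Rightarrow> nat \<Rightarrow> ('a \<Rightarrow> 'b) \<Rightarrow> bool"
  where
  "descends v n w m g \<longleftrightarrow>
     (\<forall>x y. hclass v n x = hclass v n y \<longrightarrow> hclass w m (g x) = hclass w m (g y))"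

end

theory Submission
  imports Defs
begin

text \<open>
  A homomorphism \<open>f\<close> of hyperfields over \<open>p\<close> is turned into a field homomorphism by following
  the structure of a complete tamely ramified field: every element of \<open>K1\<close> is a convergent sum of
  monomials \<open>t \<pi> ^ i / p ^ N\<close>, where \<open>t\<close> is a Teichmueller element and \<open>\<pi>\<close> is a uniformizer with
  \<open>\<pi> ^ e = p \<theta>\<close> for a Teichmueller element \<open>\<theta>\<close>. Perfectness of the residue field provides the
  Teichmueller elements, and tameness provides \<open>\<pi>\<close>, by extracting an \<open>e\<close>-th root of an element near 1.

  Choose representatives \<open>F x\<close> of the images of all classes. A Teichmueller element has \<open>p\<close>-power roots
  of every order, and raising to \<open>p\<close>-th powers improves congruences; hence the images under \<open>F\<close> of its
  roots determine a Teichmueller element of \<open>K2\<close>, which agrees with \<open>F\<close> to full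
  precision (\<open>coherent_roots\<close>, \<open>teich_exists\<close>, \<open>teich_near\<close>). Since \<open>f\<close> fixes the class of \<open>p\<close>, the equation
  for \<open>\<pi>\<close> holds for \<open>F \<pi>\<close> up to a class, and an \<open>e\<close>-th root corrects \<open>F \<pi>\<close> to a matching \<open>\<omega>\<close>
  (\<open>uniformizer_pair_exists\<close>). This prescribes the images of all monomials.

  The heart of the matter is that the prescription is compatible with addition: a sum of monomials
  that is small in \<open>K1\<close> must have a small image in \<open>K2\<close>. For sums of Teichmueller elements this is
  shown without Witt vectors (\<open>teich_ring_step\<close>). Consider the subring of \<open>K1 \<times> K2\<close> generated by
  matching pairs of Teichmueller elements. Modulo \<open>p\<close>, each of its elements is a \<open>p ^ k\<close>-th power of another one,
  for every \<open>k\<close>. If the first component is small, the base of that power has positive value, in both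
  fields because \<open>F\<close> respects residues; so for large \<open>k\<close> the power is negligible, and one divides by
  \<open>p\<close> and iterates. The same argument shows that such elements have integral values, so in a sum
  of the form \<open>\<Sum>i<e. a i * \<pi> ^ i\<close> no cancellation between different \<open>i\<close> is possible, which extends the
  claim to sums of monomials (\<open>span_transfer\<close>).

  The closure of the additive group of pairs generated by the monomials is therefore the graph of a
  field homomorphism. It induces \<open>f\<close>, because \<open>F\<close> is additive up to its precision, and any
  homomorphism inducing \<open>f\<close> is forced on Teichmueller elements and on \<open>\<pi>\<close>, hence everywhere
  (\<open>ex1_lift\<close>).

  Consequently sending \<open>f\<close> to its lift is injective, and its image consists of the field
  homomorphisms that are well defined on classes. As field homomorphisms preserve values, this
  condition depends only on \<open>n\<close>, \<open>m\<close> and the ramification indices (\<open>descends_iff\<close>).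
\<close>

section \<open>Elementary properties of the valuation\<close>

text \<open>
  Bounding values from below by a real number avoids arithmetic with infinite values: the bounds of
  sums and products need no case distinction for the element 0.
\<close>

definition val_ge :: "('a::field_char_0 \<Rightarrow> ereal) \<Rightarrow> real \<Rightarrow> 'a \<Rightarrow> bool" where
  "val_ge v r x \<longleftrightarrow> ereal r \<le> v x"

text \<open>
  The correction term is an explicit polynomial with integer coefficients, so that the same formula
  can be read in two rings at once.
\<close>

lemma add_power_prime:
  fixes a b :: "'a::comm_ring_1"
  assumes "Factorial_Ring.prime (p::nat)"
  shows "(a + b) ^ p = a ^ p + b ^ p +
      of_nat p * (\<Sum>i\<in>{1..<p}. of_nat ((p choose i) div p) * a ^ i * b ^ (p - i))"
proof -
  have p: "p > 1" using assms prime_gt_1_nat by blast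
  have s: "{..p} = insert 0 (insert p {1..<p})" using p by auto
  have "(a + b) ^ p = (\<Sum>k\<le>p. of_nat (p choose k) * a ^ k * b ^ (p - k))"
    by (rule binomial_ring)
  also have "\<dots> = b ^ p + (a ^ p + (\<Sum>k\<in>{1..<p}. of_nat (p choose k) * a ^ k * b ^ (p - k)))"
    unfolding s using p by simp
  also have "(\<Sum>k\<in>{1..<p}. of_nat (p choose k) * a ^ k * b ^ (p - k)) =
     of_nat p * (\<Sum>i\<in>{1..<p}. of_nat ((p choose i) div p) * a ^ i * b ^ (p - i))"
    unfolding sum_distrib_left
  proof (rule sum.cong[OF refl])
    fix k assume k: "k \<in> {1..<p}"
    have "p dvd (p choose k)"
      using k assms by (intro dvd_choose_prime) auto
    hence "of_nat (p choose k) = (of_nat p * of_nat ((p choose k) div p) :: 'a)"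
      by (metis dvd_mult_div_cancel of_nat_mult)
    thus "of_nat (p choose k) * a ^ k * b ^ (p - k) =
       of_nat p * (of_nat ((p choose k) div p) * a ^ k * b ^ (p - k))"
      by (simp add: mult.assoc)
  qed
  finally show ?thesis by (simp add: algebra_simps)
qed

context mixed_char_discrete_valuation
begin

abbreviation ge where "ge \<equiv> val_ge v"
abbreviation e where "e \<equiv> ramification_index v p"
text \<open>
  The value of a uniformizer, hence the generator of the value group: \<open>p\<close> has value 1 and is the
  \<open>e\<close>-th power of a uniformizer up to a unit.
\<close>

definition u :: real where "u = 1 / real e"

lemma v_0: "v 0 = \<infinity>" using eq_infinity_iff by simp

lemma v_real: "x \<noteq> 0 \<Longrightarrow> \<exists>r. v x = ereal r"
proof -
  assume "x \<noteq> 0"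
  hence "v x \<in> v ` (UNIV - {0})" by blast
  thus ?thesis using discrete by auto
qed

lemma v_1: "v 1 = 0"
proof -
  obtain r where "v 1 = ereal r" using v_real[of 1] by auto
  moreover have "v 1 = v 1 + v 1" using mult[of 1 1] by simp
  ultimately show ?thesis by simp
qed

lemma v_minus: "v (- x) = v x"
proof -
  obtain r where r: "v (-1) = ereal r" using v_real[of "-1"] by auto
  have "v 1 = v (-1) + v (-1)" using mult[of "-1" "-1"] by simp
  hence "v (-1) = 0" using r v_1 by (simp add: zero_ereal_def)
  thus ?thesis using mult[of "-1" x] by simp
qed

lemma v_inverse: "v x = ereal r \<Longrightarrow> v (1 / x) = ereal (- r)"
proof -
  assume r: "v x = ereal r"
  hence x: "x \<noteq> 0" using v_0 by auto
  then obtain s where s: "v (1 / x) = ereal s" using v_real by fastforce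
  have "v 1 = v x + v (1 / x)" using mult[of x "1 / x"] x by simp
  thus ?thesis using r s v_1 by (simp add: zero_ereal_def)
qed

lemma v_divide: "v x = ereal r \<Longrightarrow> v y = ereal s \<Longrightarrow> v (x / y) = ereal (r - s)"
  using v_inverse[of y s] mult[of x "1 / y"] by simp

lemma v_mult: "v x = ereal r \<Longrightarrow> v y = ereal s \<Longrightarrow> v (x * y) = ereal (r + s)"
  using mult[of x y] by simp

lemma v_power: "v x = ereal r \<Longrightarrow> v (x ^ k) = ereal (real k * r)"
proof (induction k)
  case 0 thus ?case by (simp add: v_1 zero_ereal_def)
next
  case (Suc k) thus ?case using v_mult[of x r "x ^ k" "real k * r"] by (simp add: algebra_simps)
qed

lemma v_p: "v (of_nat p) = ereal 1" using normalized by (simp add: one_ereal_def)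

lemma p_nz: "(of_nat p :: 'a) \<noteq> 0" proof
  assume "(of_nat p :: 'a) = 0"
  thus False using normalized v_0 by (simp add: one_ereal_def)
qed

lemma v_nz: "v x = ereal r \<Longrightarrow> x \<noteq> 0" using v_0 by auto

lemma ge_iff: "v x = ereal s \<Longrightarrow> ge r x \<longleftrightarrow> r \<le> s" by (simp add: val_ge_def)

lemma ge_0 [simp]: "ge r 0" by (simp add: val_ge_def v_0)

lemma ge_mono: "ge r x \<Longrightarrow> s \<le> r \<Longrightarrow> ge s x"
  unfolding val_ge_def by (meson ereal_less_eq(3) order_trans)

lemma ge_minus_iff [simp]: "ge r (- x) \<longleftrightarrow> ge r x"
  by (simp add: val_ge_def v_minus)

lemma ge_commute: "ge r (x - y) \<longleftrightarrow> ge r (y - x)"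
  by (metis ge_minus_iff minus_diff_eq)

lemma ge_add: "ge r x \<Longrightarrow> ge r y \<Longrightarrow> ge r (x + y)"
  unfolding val_ge_def using add[of x y] by (meson min.boundedI order_trans)

lemma ge_diff: "ge r x \<Longrightarrow> ge r y \<Longrightarrow> ge r (x - y)"
  using ge_add[of r x "- y"] by simp

lemma ge_diff_trans: "ge r (x - y) \<Longrightarrow> ge r (y - z) \<Longrightarrow> ge r (x - z)"
  using ge_add[of r "x - y" "y - z"] by simp

lemma ge_shift: "ge r (x - y) \<Longrightarrow> ge r y \<Longrightarrow> ge r x"
  using ge_add[of r "x - y" y] by simp

lemma ge_sum: "(\<And>i. i \<in> A \<Longrightarrow> ge r (f i)) \<Longrightarrow> ge r (sum f A)"
  by (induction A rule: infinite_finite_induct) (auto intro: ge_add)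

lemma ge_mult: "ge r x \<Longrightarrow> ge s y \<Longrightarrow> ge (r + s) (x * y)"
proof -
  assume a: "ge r x" "ge s y"
  show ?thesis
  proof (cases "x = 0 \<or> y = 0")
    case False
    then obtain a b where "v x = ereal a" "v y = ereal b" using v_real by blast
    thus ?thesis using a by (simp add: val_ge_def mult)
  qed auto
qed

lemma ge_mult0: "ge 0 x \<Longrightarrow> ge s y \<Longrightarrow> ge s (x * y)"
  using ge_mult[of 0 x s y] by simp

lemma ge_mult0': "ge s x \<Longrightarrow> ge 0 y \<Longrightarrow> ge s (x * y)"
  using ge_mult[of s x 0 y] by simp

lemma ge_1 [simp]: "ge 0 1" by (simp add: val_ge_def v_1 zero_ereal_def)

lemma ge_power: "ge r x \<Longrightarrow> ge (real k * r) (x ^ k)"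
proof (induction k)
  case (Suc k) thus ?case using ge_mult[of r x "real k * r" "x ^ k"] by (simp add: algebra_simps)
qed simp

lemma ge_power0: "ge 0 x \<Longrightarrow> ge 0 (x ^ k)"
  using ge_power[of 0 x k] by simp

lemma ge_of_nat [simp]: "ge 0 (of_nat k)"
  by (induction k) (auto intro: ge_add)

lemma ge_p: "ge 1 (of_nat p)" by (simp add: val_ge_def v_p)

lemma ge_scale: "v x = ereal s \<Longrightarrow> ge (s + r) (x * y) \<longleftrightarrow> ge r y"
proof -
  assume s: "v x = ereal s"
  show ?thesis
  proof (cases "y = 0")
    case False
    then obtain b where "v y = ereal b" using v_real by blast
    thus ?thesis using s by (simp add: val_ge_def mult)
  qed auto
qed

lemma eq_0I: "(\<And>r. ge r x) \<Longrightarrow> x = 0"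
proof (rule ccontr)
  assume a: "\<And>r. ge r x" "x \<noteq> 0"
  then obtain b where "v x = ereal b" using v_real by blast
  thus False using a(1)[of "b + 1"] by (simp add: val_ge_def)
qed

text \<open>
  Identities between limits are proved by this rule: both sides agree to every precision.
\<close>

lemma eq_0I_step: "d > 0 \<Longrightarrow> (\<And>k::nat. ge (r + real k * d) x) \<Longrightarrow> x = 0"
proof (rule eq_0I)
  fix s assume d: "d > (0::real)" and *: "\<And>k::nat. ge (r + real k * d) x"
  obtain k :: nat where "(s - r) / d < real k" using reals_Archimedean2 by blast
  hence "s \<le> r + real k * d" using d by (simp add: field_simps)
  thus "ge s x" using * ge_mono by blast
qed

lemma v_eq_diff: "v x = ereal r \<Longrightarrow> ge s (x - y) \<Longrightarrow> r < s \<Longrightarrow> v y = ereal r"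
proof -
  assume a: "v x = ereal r" "ge s (x - y)" "r < s"
  have "y \<noteq> 0" using a by (auto simp: val_ge_def)
  then obtain t where t: "v y = ereal t" using v_real by blast
  have xy: "ge (min s t) (x - y)" "ge (min s r) (y - x)"
    using ge_mono[OF a(2)] ge_commute by auto
  have "ge (min s t) x" using ge_shift[OF xy(1)] t by (auto simp: ge_iff)
  moreover have "ge (min s r) y" using ge_shift[OF xy(2)] a by (auto simp: ge_iff)
  ultimately show ?thesis using a t by (auto simp: ge_iff)
qed

section \<open>Powers of the maximal ideal and the ramification index\<close>

lemma cring_valuation_ring: "cring (valuation_ring v)"
proof (rule cringI)
  show "abelian_group (valuation_ring v)"
  proof (rule abelian_groupI)
    fix x assume "x \<in> carrier (valuation_ring v)"
    thus "\<exists>y\<in>carrier (valuation_ring v). y \<oplus>\<^bsub>valuation_ring v\<^esub> x = \<zero>\<^bsub>valuation_ring v\<^esub>"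
      by (intro bexI[of _ "- x"]) (auto simp: valuation_ring_def v_minus)
  next
    fix x y assume "x \<in> carrier (valuation_ring v)" "y \<in> carrier (valuation_ring v)"
    thus "x \<oplus>\<^bsub>valuation_ring v\<^esub> y \<in> carrier (valuation_ring v)"
      using ge_add[of 0 x y] by (simp add: valuation_ring_def val_ge_def zero_ereal_def)
  qed (auto simp: valuation_ring_def v_0 algebra_simps)
next
  show "Group.comm_monoid (valuation_ring v)"
    by (rule comm_monoidI)
      (auto simp: valuation_ring_def v_1 mult algebra_simps)
qed (auto simp: valuation_ring_def algebra_simps)


lemma uniformizer_value:
  obtains c k where "c > 0" "k > 0" "c * real k = 1"
    "\<And>x. x \<noteq> 0 \<Longrightarrow> \<exists>i::int. v x = ereal (c * real_of_int i)"
    "\<And>i::int. \<exists>x. v x = ereal (c * real_of_int i)"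
proof -
  obtain c where c: "c > 0" "v ` (UNIV - {0}) = range (\<lambda>k::int. ereal (c * real_of_int k))"
    using discrete by blast
  have 1: "\<exists>i::int. v x = ereal (c * real_of_int i)" if "x \<noteq> 0" for x
  proof -
    have "v x \<in> v ` (UNIV - {0})" using that by simp
    thus ?thesis unfolding c(2) by auto
  qed
  have 2: "\<exists>x. v x = ereal (c * real_of_int i)" for i :: int
  proof -
    have "ereal (c * real_of_int i) \<in> v ` (UNIV - {0})" unfolding c(2) by (rule rangeI)
    thus ?thesis by (metis imageE)
  qed
  obtain i :: int where i: "v (of_nat p) = ereal (c * real_of_int i)" using 1[OF p_nz] by (elim exE)
  hence ci: "c * real_of_int i = 1" using v_p by simp
  have "i > 0"
  proof (rule ccontr)
    assume "\<not> i > 0"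
    hence "c * real_of_int i \<le> 0" using c(1) by (intro mult_nonneg_nonpos) auto
    thus False using ci by simp
  qed
  hence "nat i > 0" "c * real (nat i) = 1" using ci by simp_all
  thus ?thesis using that[OF c(1) _ _ 1 2] by blast
qed

text \<open>
  The product of ideals is generated by products, so a lower bound on values is inherited; conversely
  an element of value at least \<open>(n + 1) c\<close> is \<open>(x / \<pi>) \<pi>\<close> with \<open>\<pi>\<close> a uniformizer.
\<close>

lemma maximal_ideal_power_c:
  assumes c: "c > 0" "\<And>x. x \<noteq> 0 \<Longrightarrow> \<exists>i::int. v x = ereal (c * real_of_int i)"
     "\<And>i::int. \<exists>x. v x = ereal (c * real_of_int i)"
  shows "maximal_ideal_power v n = {x. ge (real n * c) x}"
proof -
  have mi: "maximal_ideal v = {x. ge c x}"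
  proof -
    have "0 < v x \<longleftrightarrow> ge c x" for x
    proof (cases "x = 0")
      case False
      then obtain i :: int where i: "v x = ereal (c * real_of_int i)" using c(2) by blast
      have "0 < i \<longleftrightarrow> 1 \<le> i" by auto
      hence "0 < real_of_int i \<longleftrightarrow> 1 \<le> real_of_int i" by linarith
      thus ?thesis using c(1) by (simp add: val_ge_def i zero_less_mult_iff)
    qed (simp add: v_0)
    thus ?thesis by (simp add: maximal_ideal_def)
  qed
  show ?thesis
  proof (induction n)
    case 0
    show ?case by (simp add: maximal_ideal_power_def ideals_set_def valuation_ring_def val_ge_def
          zero_ereal_def)
  next
    case (Suc n)
    have "maximal_ideal_power v (Suc n) =
      ideal_prod (valuation_ring v) {x. ge (real n * c) x} {x. ge c x}"
      using Suc mi by (simp add: maximal_ideal_power_def ideals_set_def)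
    also have "\<dots> = {x. ge (real (Suc n) * c) x}"
    proof (intro subset_antisym subsetI)
      fix x assume "x \<in> ideal_prod (valuation_ring v) {x. ge (real n * c) x} {x. ge c x}"
      thus "x \<in> {x. ge (real (Suc n) * c) x}"
      proof induction
        case (prod i j)
        thus ?case using ge_mult[of "real n * c" i c j]
          by (simp add: valuation_ring_def algebra_simps)
      next
        case (sum s t)
        thus ?case using ge_add by (simp add: valuation_ring_def)
      qed
    next
      fix x assume x: "x \<in> {x. ge (real (Suc n) * c) x}"
      obtain \<pi> where \<pi>: "v \<pi> = ereal c" using c(3)[of 1] by auto
      have eq: "x = (x / \<pi>) * \<pi>" using v_nz[OF \<pi>] by simp
      have "ge (c + real n * c) (\<pi> * (x / \<pi>))"
        using x v_nz[OF \<pi>] by (simp add: algebra_simps)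
      hence "ge (real n * c) (x / \<pi>)" using ge_scale[OF \<pi>] by blast
      hence "(x / \<pi>) \<otimes>\<^bsub>valuation_ring v\<^esub> \<pi> \<in>
           ideal_prod (valuation_ring v) {x. ge (real n * c) x} {x. ge c x}"
        by (intro ideal_prod.prod) (auto simp: val_ge_def \<pi>)
      thus "x \<in> ideal_prod (valuation_ring v) {x. ge (real n * c) x} {x. ge c x}"
        using eq by (simp add: valuation_ring_def)
    qed
    finally show ?case .
  qed
qed

text \<open>
  Both \<open>p R\<close> and the powers of the maximal ideal are determined by a bound on values, and distinct
  bounds in the value group give distinct ideals; this makes the description of \<open>e\<close> unique.
\<close>

lemma ramification_index_c:
  assumes c: "c > 0" "c * real k = 1"
     "\<And>x. x \<noteq> 0 \<Longrightarrow> \<exists>i::int. v x = ereal (c * real_of_int i)"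
     "\<And>i::int. \<exists>x. v x = ereal (c * real_of_int i)"
  shows "ramification_index v p = k"
proof -
  note mp = maximal_ideal_power_c[OF c(1,3,4)]
  have P: "PIdl\<^bsub>valuation_ring v\<^esub> (of_nat p) = {x. ge 1 x}"
  proof -
    have "ge 1 x \<longleftrightarrow> (\<exists>y. ge 0 y \<and> x = y * of_nat p)" for x
    proof
      assume "ge 1 x"
      hence "ge (1 + 0) (of_nat p * (x / of_nat p))" using p_nz by simp
      hence "ge 0 (x / of_nat p)" using ge_scale[OF v_p] by blast
      thus "\<exists>y. ge 0 y \<and> x = y * of_nat p" using p_nz by (intro exI[of _ "x / of_nat p"]) simp
    next
      assume "\<exists>y. ge 0 y \<and> x = y * of_nat p"
      thus "ge 1 x" using ge_mult0 ge_p by blast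
    qed
    thus ?thesis by (auto simp: cgenideal_def valuation_ring_def val_ge_def zero_ereal_def)
  qed
  have "PIdl\<^bsub>valuation_ring v\<^esub> (of_nat p) = maximal_ideal_power v j \<longleftrightarrow> j = k" for j
  proof
    assume "PIdl\<^bsub>valuation_ring v\<^esub> (of_nat p) = maximal_ideal_power v j"
    hence "{x. ge 1 x} = maximal_ideal_power v j" using P by simp
    also have "\<dots> = {x. ge (real j * c) x}" by (rule mp)
    finally have "{x. ge 1 x} = {x. ge (real j * c) x}" .
    hence eq: "ge 1 x \<longleftrightarrow> ge (real j * c) x" for x unfolding set_eq_iff mem_Collect_eq by (rule spec)
    obtain x where x: "v x = ereal (c * real_of_int (int j))" using c(4) by blast
    hence "1 \<le> c * real j" using eq[of x] by (simp add: ge_iff mult.commute)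
    moreover have "real j * c \<le> 1" using eq[of "of_nat p"] by (simp add: ge_iff[OF v_p])
    ultimately have "c * real j = c * real k" using c(2) by (simp add: mult.commute)
    thus "j = k" using c(1) by simp
  next
    assume "j = k"
    hence "real j * c = 1" using c(2) by (simp add: mult.commute)
    hence "maximal_ideal_power v j = {x. ge 1 x}" using mp[of j] by simp
    thus "PIdl\<^bsub>valuation_ring v\<^esub> (of_nat p) = maximal_ideal_power v j"
      using P by simp
  qed
  thus ?thesis unfolding ramification_index_def by simp
qed

lemma shows e_pos: "e > 0"
  and v_u: "x \<noteq> 0 \<Longrightarrow> \<exists>i::int. v x = ereal (u * real_of_int i)"
  and ex_v: "\<exists>x. v x = ereal (u * real_of_int i)"
  and maximal_ideal_power_eq: "maximal_ideal_power v n = {x. ge (real n * u) x}"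
proof -
  obtain c k where c: "c > 0" "k > 0" "c * real k = 1"
    "\<And>x. x \<noteq> 0 \<Longrightarrow> \<exists>i::int. v x = ereal (c * real_of_int i)"
    "\<And>i::int. \<exists>x. v x = ereal (c * real_of_int i)" using uniformizer_value by metis
  have k: "e = k" using ramification_index_c[OF c(1,3-5)] .
  have u: "u = c" using c unfolding u_def k by (simp add: field_simps)
  show "e > 0" "x \<noteq> 0 \<Longrightarrow> \<exists>i::int. v x = ereal (u * real_of_int i)"
    "\<exists>x. v x = ereal (u * real_of_int i)"
    using c k u by auto
  show "maximal_ideal_power v n = {x. ge (real n * u) x}"
    using maximal_ideal_power_c[OF c(1,4,5)] u by simp
qed

lemma u_pos: "u > 0" using e_pos by (simp add: u_def)
lemma u_le_1: "u \<le> 1" using e_pos by (simp add: u_def)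
lemma e_u: "real e * u = 1" using e_pos by (simp add: u_def)

text \<open>
  Discreteness turns a strict bound into the next multiple of \<open>u\<close>.
\<close>

lemma ge_discrete:
  assumes "ge r x" "r > real_of_int k * u"
  shows "ge ((real_of_int k + 1) * u) x"
proof (cases "x = 0")
  case False
  then obtain i :: int where i: "v x = ereal (u * real_of_int i)" using v_u by blast
  hence "u * real_of_int k < u * real_of_int i" using assms by (simp add: ge_iff mult.commute)
  hence "k < i" using u_pos by simp
  hence "real_of_int k + 1 \<le> real_of_int i" by linarith
  thus ?thesis using u_pos by (simp add: ge_iff[OF i])
qed simp

lemma ge_pos: "ge r x \<Longrightarrow> r > 0 \<Longrightarrow> ge u x"
  using ge_discrete[of r x 0] by simp

lemma ge_power_pos: "ge u (x ^ k) \<Longrightarrow> ge u x"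
proof (cases "x = 0")
  case False
  assume a: "ge u (x ^ k)"
  obtain r where r: "v x = ereal r" using v_real False by blast
  have "u \<le> real k * r" using a by (simp add: ge_iff[OF v_power[OF r]])
  hence "r > 0" using u_pos mult_nonneg_nonpos[of "real k" r] by (cases "r > 0") auto
  thus ?thesis using ge_pos[of r x] r by (simp add: ge_iff)
qed simp

section \<open>Hyperfield classes as multiplicative congruence classes\<close>

lemma hclass_eq: "hclass v n x = {x * (1 + a) | a. ge (real n * u) a}"
  by (simp add: hclass_def maximal_ideal_power_eq)

lemma hclass_0: "hclass v n 0 = {0}"
  unfolding hclass_eq by (auto intro!: exI[of _ 0])

text \<open>
  For nonzero \<open>x\<close>, membership in the class of \<open>x\<close> is an additive congruence whose precision is
  relative to the value of \<open>x\<close>. All computations with classes go through this form.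
\<close>

lemma mem_hclass:
  assumes "v x = ereal s"
  shows "y \<in> hclass v n x \<longleftrightarrow> ge (s + real n * u) (y - x)"
proof -
  have x: "x \<noteq> 0" using v_nz assms .
  have "y \<in> hclass v n x \<longleftrightarrow> ge (real n * u) (y / x - 1)"
  proof
    assume "y \<in> hclass v n x"
    thus "ge (real n * u) (y / x - 1)" unfolding hclass_eq using x by auto
  next
    assume "ge (real n * u) (y / x - 1)"
    thus "y \<in> hclass v n x" unfolding hclass_eq using x
      by (auto intro!: exI[of _ "y / x - 1"] simp: field_simps)
  qed
  also have "\<dots> \<longleftrightarrow> ge (s + real n * u) (x * (y / x - 1))" using ge_scale[OF assms] by simp
  also have "x * (y / x - 1) = y - x" using x by (simp add: field_simps)
  finally show ?thesis .
qed

lemma hclass_self: "x \<in> hclass v n x"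
  unfolding hclass_eq by (auto intro!: exI[of _ 0])

lemma v_hclass:
  assumes "n \<ge> 1" "y \<in> hclass v n x" shows "v y = v x"
proof (cases "x = 0")
  case False
  then obtain r where r: "v x = ereal r" using v_real by blast
  have "real n * u > 0" using assms u_pos by simp
  thus ?thesis using v_eq_diff[of x r "r + real n * u" y] assms r ge_commute by (simp add: mem_hclass)
qed (use assms in \<open>simp add: hclass_0\<close>)

lemma hclass_eqI:
  assumes n: "n \<ge> 1" and y: "y \<in> hclass v n x" shows "hclass v n y = hclass v n x"
proof (cases "x = 0")
  case False
  then obtain r where r: "v x = ereal r" using v_real by blast
  have r': "v y = ereal r" using v_hclass[OF assms] r by simp
  have yx: "ge (r + real n * u) (y - x)" "ge (r + real n * u) (x - y)"
    using y ge_commute by (simp_all add: mem_hclass[OF r])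
  show ?thesis
  proof (intro Set.set_eqI)
    show "z \<in> hclass v n y \<longleftrightarrow> z \<in> hclass v n x" for z
      unfolding mem_hclass[OF r] mem_hclass[OF r'] using yx ge_diff_trans by blast
  qed
qed (use assms in \<open>simp add: hclass_0\<close>)

lemma hclass_eq_iff: "n \<ge> 1 \<Longrightarrow> hclass v n y = hclass v n x \<longleftrightarrow> y \<in> hclass v n x"
  using hclass_eqI hclass_self by blast

lemma hclass_eq_diff:
  "n \<ge> 1 \<Longrightarrow> v x = ereal s \<Longrightarrow> hclass v n y = hclass v n x \<longleftrightarrow> ge (s + real n * u) (y - x)"
  by (simp add: hclass_eq_iff mem_hclass)

lemma hclass_mult:
  assumes "n \<ge> 1" "hclass v n x = hclass v n x'" "hclass v n y = hclass v n y'"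
  shows "hclass v n (x * y) = hclass v n (x' * y')"
proof -
  have "x \<in> hclass v n x'" "y \<in> hclass v n y'" using assms hclass_self by blast+
  then obtain a b where a: "ge (real n * u) a" "x = x' * (1 + a)"
    and b: "ge (real n * u) b" "y = y' * (1 + b)" unfolding hclass_eq by blast
  have "ge 0 b" using b ge_mono u_pos by (meson less_imp_le mult_nonneg_nonneg of_nat_0_le_iff)
  hence "ge (real n * u) (a * b)" using a ge_mult0' by blast
  hence "ge (real n * u) (a + b + a * b)" using a b ge_add by blast
  hence "x * y \<in> hclass v n (x' * y')" unfolding hclass_eq a b
    by (auto intro!: exI[of _ "a + b + a * b"] simp: algebra_simps)
  thus ?thesis using assms hclass_eqI by blast
qed

lemma hclass_power:
  assumes "n \<ge> 1" "hclass v n x = hclass v n x'"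
  shows "hclass v n (x ^ k) = hclass v n (x' ^ k)"
proof (induction k)
  case (Suc k) thus ?case using hclass_mult[OF assms] by simp
qed simp

section \<open>Powers of congruent elements\<close>

lemma p_gt_1: "p > 1" using prime_p prime_gt_1_nat by blast

text \<open>
  Raising to the \<open>p\<close>-th power improves a congruence by one step: in \<open>(b + d) ^ p\<close> the mixed terms
  gain a factor \<open>p\<close>, and \<open>d ^ p\<close> is small because \<open>p \<ge> 2\<close>. This is what makes Teichmueller limits
  converge.
\<close>

lemma power_p_contract:
  assumes b: "ge 0 b" and ab: "ge (real (Suc j) * u) (a - b)"
  shows "ge (real (Suc (Suc j)) * u) (a ^ p - b ^ p)"
proof -
  define d where "d = a - b"
  define S where "S = (\<Sum>i\<in>{1..<p}. of_nat ((p choose i) div p) * d ^ i * b ^ (p - i))"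
  have "a ^ p = (d + b) ^ p" by (simp add: d_def)
  also have "\<dots> = d ^ p + b ^ p + of_nat p * S"
    unfolding S_def by (rule add_power_prime[OF prime_p])
  finally have eq: "a ^ p - b ^ p = d ^ p + of_nat p * S" by simp
  have d: "ge (real (Suc j) * u) d" using ab by (simp add: d_def)
  have d0: "ge 0 d" using d u_pos ge_mono by (meson less_imp_le mult_nonneg_nonneg of_nat_0_le_iff)
  have "ge (real (Suc j) * u) (of_nat ((p choose i) div p) * d ^ i * b ^ (p - i))"
    if "i \<in> {1..<p}" for i
  proof -
    have "d ^ i = d * d ^ (i - 1)" using that by (simp add: power_eq_if)
    hence "ge (real (Suc j) * u) (d ^ i)" using ge_mult0'[OF d ge_power0[OF d0]] by simp
    thus ?thesis using ge_mult0' ge_mult0 ge_power0[OF b] by (meson ge_of_nat)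
  qed
  hence "ge (real (Suc j) * u) S" unfolding S_def by (rule ge_sum)
  hence "ge (1 + real (Suc j) * u) (of_nat p * S)" by (rule ge_mult[OF ge_p])
  hence 1: "ge (real (Suc (Suc j)) * u) (of_nat p * S)"
    by (rule ge_mono) (use u_le_1 in \<open>simp add: algebra_simps\<close>)
  have "real (Suc (Suc j)) \<le> real p * real (Suc j)"
  proof -
    have "2 * Suc j \<le> p * Suc j" using p_gt_1 by (intro mult_le_mono) auto
    hence "Suc (Suc j) \<le> p * Suc j" by simp
    thus ?thesis using of_nat_mono by (metis of_nat_mult)
  qed
  hence "real (Suc (Suc j)) * u \<le> real p * (real (Suc j) * u)"
    using u_pos by (metis mult.assoc mult_right_mono less_imp_le)
  hence "ge (real (Suc (Suc j)) * u) (d ^ p)" using ge_power[OF d] ge_mono by blast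
  thus ?thesis unfolding eq using 1 by (rule ge_add)
qed

lemma power_pk_contract:
  assumes b: "ge 0 b" and ab: "ge u (a - b)"
  shows "ge (real (Suc k) * u) (a ^ (p ^ k) - b ^ (p ^ k))"
proof (induction k)
  case (Suc k)
  show ?case using power_p_contract[OF ge_power0[OF b] Suc]
    by (simp add: power_mult[symmetric] mult.commute)
qed (use ab in simp)

text \<open>
  A Bezout identity \<open>q x - p y = 1\<close> cannot hold modulo the maximal ideal unless \<open>q\<close> is a unit.
\<close>

lemma v_of_nat_unit:
  assumes "\<not> p dvd q" shows "v (of_nat q) = 0"
proof -
  have q: "q \<noteq> 0" using assms by (intro notI) simp
  have "coprime p q" using assms prime_p by (simp add: prime_imp_coprime)
  hence "gcd q p = 1" by (simp add: coprime_iff_gcd_eq_1 gcd.commute)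
  then obtain x y where "q * x = p * y + 1" using bezout_nat[OF q, of p] by auto
  hence "(of_nat (q * x) :: 'a) = of_nat (p * y + 1)" by simp
  hence eq: "(1 :: 'a) = of_nat q * of_nat x - of_nat p * of_nat y" by simp
  obtain r where r: "v (of_nat q) = ereal r" using v_real q by fastforce
  have "r \<ge> 0" using ge_of_nat[of q] by (simp add: ge_iff[OF r])
  moreover have "\<not> r > 0"
  proof
    assume "r > 0"
    hence "ge u (of_nat q)" using ge_pos[of r "of_nat q"] r by (simp add: ge_iff)
    hence "ge u (of_nat q * of_nat x)" using ge_mult0' by simp
    moreover have "ge u (of_nat p * of_nat y)"
      using ge_mult0' ge_mono[OF ge_p u_le_1] by simp
    ultimately have "ge u 1" using eq ge_diff by metis
    thus False using u_pos by (simp add: val_ge_def v_1)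
  qed
  ultimately show ?thesis using r by simp
qed

lemma ge_one_mult:
  assumes "\<delta> \<ge> 0" "ge \<delta> (x - 1)" "ge \<delta> (y - 1)" shows "ge \<delta> (x * y - 1)"
proof -
  have "ge 0 (y - 1)" using assms ge_mono by blast
  hence "ge 0 y" using ge_shift[of 0 y 1] by simp
  hence "ge \<delta> ((x - 1) * y)" using assms ge_mult0' by blast
  hence "ge \<delta> ((x - 1) * y + (y - 1))" using assms ge_add by blast
  thus ?thesis by (simp add: algebra_simps)
qed

lemma ge_one_power:
  assumes "\<delta> \<ge> 0" "ge \<delta> (x - 1)" shows "ge \<delta> (x ^ k - 1)"
  by (induction k) (use assms ge_one_mult in auto)

text \<open>
  This sum is the cofactor in \<open>x ^ q - y ^ q = (x - y) \<dots>\<close>. Being close to \<open>q\<close>, it is a unit if \<open>p\<close> does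
  not divide \<open>q\<close>; existence and uniqueness of \<open>q\<close>-th roots near 1 both rest on that.
\<close>

lemma geometric_sum_near:
  assumes "\<delta> \<ge> 0" "ge \<delta> (x - 1)" "ge \<delta> (y - 1)"
  shows "ge \<delta> ((\<Sum>i<q. y ^ (q - Suc i) * x ^ i) - of_nat q)"
proof -
  have "(\<Sum>i<q. y ^ (q - Suc i) * x ^ i) - of_nat q = (\<Sum>i<q. y ^ (q - Suc i) * x ^ i - 1)"
    by (simp add: sum_subtractf)
  thus ?thesis by (simp only:) (intro ge_sum ge_one_mult ge_one_power assms)
qed

lemma root_of_unity_trivial:
  assumes q: "\<not> p dvd q" and x: "ge u (x - 1)" "x ^ q = 1" shows "x = 1"
proof -
  define S where "S = (\<Sum>i<q. 1 ^ (q - Suc i) * x ^ i)"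
  have "ge u (S - of_nat q)" unfolding S_def
    using geometric_sum_near[of u x 1 q] x u_pos by simp
  hence "v S = ereal 0" using v_eq_diff[of "of_nat q" 0 u S] v_of_nat_unit[OF q] u_pos ge_commute
    by (simp add: zero_ereal_def)
  hence "S \<noteq> 0" by (rule v_nz)
  moreover have "x ^ q - 1 ^ q = (x - 1) * S" unfolding S_def by (rule power_diff_sumr2)
  ultimately show ?thesis using x(2) by simp
qed

section \<open>Perfect residue fields\<close>

lemma pos_iff_ge_u: "0 < v x \<longleftrightarrow> ge u x"
proof (cases "x = 0")
  case False
  then obtain r where r: "v x = ereal r" using v_real by blast
  show ?thesis using ge_pos[of r x] u_pos by (auto simp: ge_iff[OF r] r)
qed (simp add: v_0)

lemma ideal_maximal_ideal: "ideal (maximal_ideal v) (valuation_ring v)"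
proof -
  interpret R: cring "valuation_ring v" by (rule cring_valuation_ring)
  have m: "maximal_ideal v = {x. ge u x}" by (simp add: maximal_ideal_def pos_iff_ge_u)
  have inv: "inv\<^bsub>add_monoid (valuation_ring v)\<^esub> x = - x" if "ge 0 x" for x
  proof -
    have x: "x \<in> carrier (valuation_ring v)" "- x \<in> carrier (valuation_ring v)"
      using that by (simp_all add: valuation_ring_def val_ge_def v_minus zero_ereal_def)
    have "- x \<oplus>\<^bsub>valuation_ring v\<^esub> x = \<zero>\<^bsub>valuation_ring v\<^esub>" by (simp add: valuation_ring_def)
    hence "\<ominus>\<^bsub>valuation_ring v\<^esub> x = - x" using x by (rule R.minus_equality)
    thus ?thesis by (simp add: a_inv_def)
  qed
  show ?thesis
  proof (rule idealI)
    show "ring (valuation_ring v)" by (rule R.ring_axioms)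
  next
    show "subgroup (maximal_ideal v) (add_monoid (valuation_ring v))"
    proof
      show "maximal_ideal v \<subseteq> carrier (add_monoid (valuation_ring v))"
        by (auto simp: maximal_ideal_def valuation_ring_def)
    next
      fix x y assume "x \<in> maximal_ideal v" "y \<in> maximal_ideal v"
      thus "x \<otimes>\<^bsub>add_monoid (valuation_ring v)\<^esub> y \<in> maximal_ideal v"
        using ge_add by (simp add: m valuation_ring_def)
    next
      show "\<one>\<^bsub>add_monoid (valuation_ring v)\<^esub> \<in> maximal_ideal v"
        by (simp add: m valuation_ring_def)
    next
      fix x assume x: "x \<in> maximal_ideal v"
      hence "ge 0 x" using ge_mono[of u x 0] u_pos by (simp add: m)
      thus "inv\<^bsub>add_monoid (valuation_ring v)\<^esub> x \<in> maximal_ideal v"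
        unfolding inv[OF \<open>ge 0 x\<close>] using x by (simp add: m)
    qed
  next
    fix a x assume "a \<in> maximal_ideal v" "x \<in> carrier (valuation_ring v)"
    hence "ge u (x * a)" "ge u (a * x)" using ge_mult0 ge_mult0'
      by (auto simp: m valuation_ring_def val_ge_def zero_ereal_def)
    thus "x \<otimes>\<^bsub>valuation_ring v\<^esub> a \<in> maximal_ideal v"
      "a \<otimes>\<^bsub>valuation_ring v\<^esub> x \<in> maximal_ideal v"
      by (simp_all add: m valuation_ring_def)
  qed
qed

text \<open>
  The form in which perfectness enters the construction of Teichmueller elements. The quotient ring
  has characteristic \<open>p\<close>, because \<open>p\<close> lies in the maximal ideal.
\<close>

lemma perfect_residue:
  assumes perf: "perfect_field (residue_field v)" and x: "ge 0 x"
  shows "\<exists>y. ge 0 y \<and> ge u (x - y ^ p)"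
proof -
  define R where "R = valuation_ring v"
  define I where "I = maximal_ideal v"
  have m: "I = {x. ge u x}" by (simp add: I_def maximal_ideal_def pos_iff_ge_u)
  interpret I: ideal I R unfolding I_def R_def by (rule ideal_maximal_ideal)
  have carr: "a \<in> carrier R \<longleftrightarrow> ge 0 a" for a
    by (simp add: R_def valuation_ring_def val_ge_def zero_ereal_def)
  have R_add: "a \<oplus>\<^bsub>R\<^esub> b = a + b" and R_mult: "a \<otimes>\<^bsub>R\<^esub> b = a * b" for a b
    by (simp_all add: R_def valuation_ring_def)
  have R_1: "\<one>\<^bsub>R\<^esub> = 1" and R_0: "\<zero>\<^bsub>R\<^esub> = 0" by (simp_all add: R_def valuation_ring_def)
  interpret h: ring_hom_ring R "R Quot I" "(+>\<^bsub>R\<^esub>) I" by (rule I.rcos_ring_hom_ring)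
  have Q: "residue_field v = R Quot I" by (simp add: residue_field_def R_def I_def)
  have coset: "I +>\<^bsub>R\<^esub> a = {i + a | i. i \<in> I}" for a
    by (auto simp: a_r_coset_def' R_add)
  have add_pow: "[k] \<cdot>\<^bsub>R Quot I\<^esub> \<one>\<^bsub>R Quot I\<^esub> = I +>\<^bsub>R\<^esub> of_nat k" for k :: nat
  proof (induction k)
    case 0
    show ?case using h.hom_zero by (simp add: R_0)
  next
    case (Suc k)
    have "[Suc k] \<cdot>\<^bsub>R Quot I\<^esub> \<one>\<^bsub>R Quot I\<^esub> =
      (I +>\<^bsub>R\<^esub> of_nat k) \<oplus>\<^bsub>R Quot I\<^esub> (I +>\<^bsub>R\<^esub> 1)"
      using Suc h.hom_one by (simp add: R_1)
    also have "\<dots> = I +>\<^bsub>R\<^esub> (of_nat k + 1)"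
      using h.hom_add[of "of_nat k" 1] by (simp add: carr R_add)
    finally show ?case by (simp add: add.commute)
  qed
  have "of_nat p \<in> I" using ge_mono[OF ge_p u_le_1] by (simp add: m)
  hence "I +>\<^bsub>R\<^esub> of_nat p = I" by (rule I.a_rcos_const)
  also have "I = \<zero>\<^bsub>R Quot I\<^esub>" unfolding FactRing_def by simp
  finally have "I +>\<^bsub>R\<^esub> of_nat p = \<zero>\<^bsub>R Quot I\<^esub>" .
  hence "[p] \<cdot>\<^bsub>R Quot I\<^esub> \<one>\<^bsub>R Quot I\<^esub> = \<zero>\<^bsub>R Quot I\<^esub>" using add_pow by simp
  moreover have "I +>\<^bsub>R\<^esub> x \<in> carrier (R Quot I)" using h.hom_closed x carr by blast
  ultimately obtain y where y: "y \<in> carrier (R Quot I)" "y [^]\<^bsub>R Quot I\<^esub> p = I +>\<^bsub>R\<^esub> x"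
    using perf prime_p unfolding perfect_field_def Q by blast
  have "y \<in> (\<Union>a\<in>carrier R. {I +>\<^bsub>R\<^esub> a})"
    using y(1) unfolding FactRing_def A_RCOSETS_def' by (simp only: partial_object.simps)
  then obtain b where b: "ge 0 b" "y = I +>\<^bsub>R\<^esub> b" unfolding carr[symmetric] by blast
  have pow: "(I +>\<^bsub>R\<^esub> b) [^]\<^bsub>R Quot I\<^esub> k = I +>\<^bsub>R\<^esub> (b ^ k)" for k :: nat
  proof (induction k)
    case 0
    show ?case using h.hom_one by (simp add: R_1)
  next
    case (Suc k)
    show ?case using Suc h.hom_mult[of "b ^ k" b] ge_power0[OF b(1)] b(1)
      by (simp add: carr R_mult mult.commute)
  qed
  have "0 \<in> I" by (simp add: m)
  have "I +>\<^bsub>R\<^esub> x = I +>\<^bsub>R\<^esub> (b ^ p)" using y(2) b(2) pow by simp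
  moreover have "x \<in> I +>\<^bsub>R\<^esub> x" unfolding coset using \<open>0 \<in> I\<close> by (auto intro!: exI[of _ 0])
  ultimately have "x \<in> {i + b ^ p | i. i \<in> I}" unfolding coset by simp
  hence "ge u (x - b ^ p)" by (auto simp: m)
  thus ?thesis using b by blast
qed

end

section \<open>Limits in complete valued fields\<close>

locale complete_mixed_valuation = mixed_char_discrete_valuation v p
  for v :: "'a::field_char_0 \<Rightarrow> ereal" and p :: nat +
  assumes complete: "valuation_complete v"
begin

lemma limit_of_steps:
  assumes d: "d > 0" and step: "\<And>j::nat. ge (r + real j * d) (s (Suc j) - s j)"
  obtains l where "\<And>j::nat. ge (r + real j * d) (s j - l)"
proof -
  have mono: "r + real j * d \<le> r + real i * d" if "j \<le> i" for i j
    using that d by (simp add: mult_right_mono)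
  have 1: "ge (r + real j * d) (s (j + i) - s j)" for i j
  proof (induction i)
    case (Suc i)
    have "ge (r + real j * d) (s (Suc (j + i)) - s (j + i))"
      by (rule ge_mono[OF step mono]) simp
    from ge_diff_trans[OF this Suc] show ?case by simp
  qed simp
  have 2: "ge (r + real N * d) (s i - s j)" if "i \<ge> N" "j \<ge> N" for i j N
  proof -
    have "ge (r + real N * d) (s i - s N)" "ge (r + real N * d) (s N - s j)"
      using 1[of N "i - N"] 1[of N "j - N"] that ge_commute by simp_all
    thus ?thesis by (rule ge_diff_trans)
  qed
  have "\<exists>N. \<forall>i\<ge>N. \<forall>j\<ge>N. ereal C \<le> v (s i - s j)" for C
  proof -
    obtain N :: nat where "(C - r) / d < real N" using reals_Archimedean2 by blast
    hence "C \<le> r + real N * d" using d by (simp add: field_simps)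
    thus ?thesis using 2 ge_mono unfolding val_ge_def[symmetric] by blast
  qed
  then obtain l where l: "\<And>C. \<exists>N. \<forall>i\<ge>N. ge C (s i - l)"
    using complete unfolding valuation_complete_def val_ge_def by blast
  have "ge (r + real j * d) (s j - l)" for j
  proof -
    obtain N where N: "\<And>i. i \<ge> N \<Longrightarrow> ge (r + real j * d) (s i - l)" using l by blast
    have "ge (r + real j * d) (s j - s (max N j))" by (rule 2) auto
    moreover have "ge (r + real j * d) (s (max N j) - l)" by (rule N) simp
    ultimately show ?thesis by (rule ge_diff_trans)
  qed
  thus ?thesis using that by blast
qed

text \<open>
  The Teichmueller construction. If each \<open>y (k + 1)\<close> is a \<open>p\<close>-th root of \<open>y k\<close> modulo the maximal
  ideal, then the powers \<open>y (k + j) ^ (p ^ j)\<close> converge as \<open>j\<close> grows, since each further \<open>p\<close>-th power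
  improves the congruence. The limits are exact \<open>p\<close>-th roots of each other.
\<close>

lemma coherent_roots:
  assumes y: "\<And>k. ge 0 (y k)" and step: "\<And>k. ge u (y (Suc k) ^ p - y k)"
  obtains \<sigma> where "\<And>k. \<sigma> (Suc k) ^ p = \<sigma> k" "\<And>k. ge u (\<sigma> k - y k)"
proof -
  have "\<exists>l. \<forall>j. ge (u + real j * u) (y (k + j) ^ (p ^ j) - l)" for k
  proof -
    have "ge (u + real j * u) (y (k + Suc j) ^ (p ^ Suc j) - y (k + j) ^ (p ^ j))" for j
      using power_pk_contract[OF y step[of "k + j"], of j]
      by (simp add: power_mult algebra_simps)
    thus ?thesis using limit_of_steps[of u u "\<lambda>j. y (k + j) ^ (p ^ j)"] u_pos by blast
  qed
  then obtain \<sigma> where \<sigma>: "\<And>k j. ge (u + real j * u) (y (k + j) ^ (p ^ j) - \<sigma> k)" by metis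
  have near: "ge u (\<sigma> k - y k)" for k using \<sigma>[of 0 k] ge_commute by simp
  have \<sigma>0: "ge 0 (\<sigma> k)" for k
  proof -
    have "ge 0 (\<sigma> k - y k)" using ge_mono[OF near] u_pos by simp
    thus ?thesis using y by (rule ge_shift)
  qed
  have "\<sigma> (Suc k) ^ p = \<sigma> k" for k
  proof -
    have "ge (0 + real j * u) (\<sigma> (Suc k) ^ p - \<sigma> k)" for j
    proof -
      have "ge (real (Suc j) * u) (y (Suc k + j) ^ (p ^ j) - \<sigma> (Suc k))"
        using \<sigma>[of j "Suc k"] by (simp add: algebra_simps)
      from power_p_contract[OF \<sigma>0 this]
      have "ge (real (Suc (Suc j)) * u) (y (k + Suc j) ^ (p ^ Suc j) - \<sigma> (Suc k) ^ p)"
        by (simp add: power_mult[symmetric] mult.commute)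
      moreover have "ge (real (Suc (Suc j)) * u) (y (k + Suc j) ^ (p ^ Suc j) - \<sigma> k)"
        using \<sigma>[of "Suc j" k] by (simp add: algebra_simps)
      ultimately have "ge (real (Suc (Suc j)) * u) (\<sigma> (Suc k) ^ p - \<sigma> k)"
        using ge_diff_trans ge_commute by blast
      thus ?thesis by (rule ge_mono) (use u_pos in simp)
    qed
    hence "\<sigma> (Suc k) ^ p - \<sigma> k = 0" by (rule eq_0I_step[OF u_pos])
    thus ?thesis by simp
  qed
  thus ?thesis using that near by blast
qed

text \<open>
  Since \<open>q\<close> is a unit, \<open>x - (x ^ q - w) / q\<close> is a contraction of the congruence class of 1, and its
  fixed point is a \<open>q\<close>-th root of \<open>w\<close>. This is where tame ramification enters.
\<close>

lemma tame_root:
  assumes q: "\<not> p dvd q" and \<delta>: "\<delta> > 0" and w: "ge \<delta> (w - 1)"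
  obtains r where "r ^ q = w" "ge \<delta> (r - 1)"
proof -
  have vq: "v (of_nat q) = ereal 0" using v_of_nat_unit[OF q] by (simp add: zero_ereal_def)
  have q0: "(of_nat q :: 'a) \<noteq> 0" using v_nz[OF vq] .
  have iq: "ge 0 (1 / of_nat q)" using v_inverse[OF vq] by (simp add: ge_iff)
  define \<Psi> where "\<Psi> x = x - (x ^ q - w) * (1 / of_nat q)" for x
  have \<Psi>1: "ge \<delta> (\<Psi> x - 1)" if "ge \<delta> (x - 1)" for x
  proof -
    have "ge \<delta> (x ^ q - 1)" using ge_one_power[OF _ that] \<delta> by simp
    hence "ge \<delta> ((x ^ q - 1) - (w - 1))" using w by (rule ge_diff)
    hence "ge \<delta> ((x ^ q - w) * (1 / of_nat q))" using ge_mult0'[OF _ iq] by simp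
    with that have "ge \<delta> ((x - 1) - (x ^ q - w) * (1 / of_nat q))" by (rule ge_diff)
    thus ?thesis by (simp add: \<Psi>_def algebra_simps)
  qed
  have contract: "ge (s + \<delta>) (\<Psi> x - \<Psi> y)"
    if "ge \<delta> (x - 1)" "ge \<delta> (y - 1)" "ge s (x - y)" for s x y
  proof -
    define S where "S = (\<Sum>i<q. y ^ (q - Suc i) * x ^ i)"
    have "ge \<delta> (of_nat q - S)" unfolding S_def
      using geometric_sum_near[of \<delta> x y q] that \<delta> ge_commute by simp
    hence *: "ge (s + \<delta>) ((x - y) * (of_nat q - S) * (1 / of_nat q))"
      using that(3) ge_mult ge_mult0'[OF _ iq] by blast
    have "x ^ q - y ^ q = (x - y) * S" unfolding S_def by (rule power_diff_sumr2)
    hence "\<Psi> x - \<Psi> y = (x - y) - ((x - y) * S) * (1 / of_nat q)"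
      unfolding \<Psi>_def by (simp add: algebra_simps add_divide_distrib[symmetric])
    also have "\<dots> = (x - y) * (of_nat q - S) * (1 / of_nat q)"
      using q0 by (simp add: field_simps)
    finally show ?thesis using * by simp
  qed
  define s where "s j = (\<Psi> ^^ j) 1" for j
  have s: "s 0 = 1" "s (Suc j) = \<Psi> (s j)" for j by (simp_all add: s_def)
  have s1: "ge \<delta> (s j - 1)" for j by (induction j) (auto simp: s intro: \<Psi>1)
  have "ge (\<delta> + real j * \<delta>) (s (Suc j) - s j)" for j
  proof (induction j)
    case 0 show ?case using s1[of 1] by (simp add: s)
  next
    case (Suc j)
    have "ge ((\<delta> + real j * \<delta>) + \<delta>) (\<Psi> (s (Suc j)) - \<Psi> (s j))"
      by (rule contract[OF s1 s1 Suc])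
    thus ?case unfolding s(2) by (simp add: algebra_simps)
  qed
  then obtain l where l: "\<And>j. ge (\<delta> + real j * \<delta>) (s j - l)"
    using limit_of_steps[OF \<delta>, of \<delta> s] by blast
  have l1: "ge \<delta> (l - 1)" using l[of 0] ge_commute by (simp add: s)
  have "ge (\<delta> + real j * \<delta>) (l - \<Psi> l)" for j
  proof -
    have "ge (\<delta> + real j * \<delta> + \<delta>) (\<Psi> (s j) - \<Psi> l)" by (rule contract[OF s1 l1 l])
    hence "ge (\<delta> + real (Suc j) * \<delta>) (s (Suc j) - \<Psi> l)" by (simp add: s algebra_simps)
    with l[of "Suc j"] have "ge (\<delta> + real (Suc j) * \<delta>) (l - \<Psi> l)"
      using ge_diff_trans ge_commute by blast
    thus ?thesis by (rule ge_mono) (use \<delta> in \<open>simp add: algebra_simps\<close>)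
  qed
  hence "l - \<Psi> l = 0" by (rule eq_0I_step[OF \<delta>])
  hence "l ^ q = w" using q0 by (simp add: \<Psi>_def)
  thus ?thesis using that l1 by blast
qed

end

section \<open>Teichmueller pairs\<close>

text \<open>
  A homomorphism of hyperfields is studied through a choice \<open>F x\<close> of a representative of the image
  of the class of \<open>x\<close>. The map \<open>F\<close> preserves values, is multiplicative up to the class of the
  product, and is additive up to an error of relative precision \<open>m\<close> steps.
\<close>

locale hyperfield_lift =
  K1: complete_mixed_valuation v1 p + K2: complete_mixed_valuation v2 p
  for v1 :: "'a::field_char_0 \<Rightarrow> ereal" and v2 :: "'b::field_char_0 \<Rightarrow> ereal" and p :: nat +
  fixes F :: "'a \<Rightarrow> 'b" and m :: nat
  assumes m_pos: "m \<ge> 1"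
    and residue_root: "K1.ge 0 x \<Longrightarrow> \<exists>y. K1.ge 0 y \<and> K1.ge K1.u (x - y ^ p)"
    and tame: "\<not> p dvd ramification_index v1 p"
    and F_0: "F 0 = 0"
    and v_F: "v2 (F x) = v1 x"
    and F_1: "hclass v2 m (F 1) = hclass v2 m 1"
    and F_p: "hclass v2 m (F (of_nat p)) = hclass v2 m (of_nat p)"
    and F_mult: "hclass v2 m (F (x * y)) = hclass v2 m (F x * F y)"
    and F_add: "K1.ge s x \<Longrightarrow> K1.ge s y \<Longrightarrow>
      K2.ge (s + real m * K2.u) (F (x + y) - (F x + F y))"
begin

definition \<delta> :: real where "\<delta> = real m * K2.u"

lemma u_le_\<delta>: "K2.u \<le> \<delta>"
proof -
  have "1 * K2.u \<le> real m * K2.u" using m_pos K2.u_pos by (intro mult_right_mono) auto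
  thus ?thesis by (simp add: \<delta>_def)
qed

lemma \<delta>_pos: "\<delta> > 0" using u_le_\<delta> K2.u_pos by linarith

lemma ge_F: "K2.ge r (F x) \<longleftrightarrow> K1.ge r x" by (simp add: val_ge_def v_F)

lemma class_diff: "v2 y = ereal s \<Longrightarrow> hclass v2 m x = hclass v2 m y \<longleftrightarrow> K2.ge (s + \<delta>) (x - y)"
  using K2.hclass_eq_diff[OF m_pos] by (simp add: \<delta>_def)

lemma F_power: "hclass v2 m (F (x ^ k)) = hclass v2 m (F x ^ k)"
proof (induction k)
  case 0 show ?case using F_1 by simp
next
  case (Suc k)
  have "hclass v2 m (F (x * x ^ k)) = hclass v2 m (F x * F (x ^ k))" by (rule F_mult)
  also have "\<dots> = hclass v2 m (F x * F x ^ k)" by (rule K2.hclass_mult[OF m_pos refl Suc])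
  finally show ?case by simp
qed

text \<open>
  A pair of matching Teichmueller representatives of \<open>K1\<close> and \<open>K2\<close>. They are recognised by
  compatible systems of \<open>p\<close>-power roots; matching means that \<open>F\<close> relates the two systems modulo the
  maximal ideal.
\<close>

definition teich :: "'a \<Rightarrow> 'b \<Rightarrow> bool" where
  "teich t s \<longleftrightarrow> (\<exists>\<tau> \<sigma>. \<tau> 0 = t \<and> \<sigma> 0 = s \<and>
     (\<forall>k::nat. \<tau> (Suc k) ^ p = \<tau> k \<and> \<sigma> (Suc k) ^ p = \<sigma> k \<and> v1 (\<tau> k) = 0 \<and>
        K2.ge K2.u (\<sigma> k - F (\<tau> k))))"

lemma v_near_F: "v1 t = 0 \<Longrightarrow> K2.ge K2.u (s - F t) \<Longrightarrow> v2 s = 0"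
  using K2.v_eq_diff[of "F t" 0 K2.u s] K2.ge_commute K2.u_pos by (simp add: v_F zero_ereal_def)

lemma teich_v: assumes "teich t s" shows "v1 t = 0" "v2 s = 0"
  using assms v_near_F unfolding teich_def by metis+

lemma F_mult_near:
  assumes "v1 x = 0" "v1 y = 0" "K2.ge K2.u (a - F x)" "K2.ge K2.u (b - F y)"
  shows "K2.ge K2.u (a * b - F (x * y))"
proof -
  have v: "v2 (F x * F y) = ereal 0" using assms by (simp add: K2.mult v_F zero_ereal_def)
  have "K2.ge (0 + \<delta>) (F (x * y) - F x * F y)" using F_mult class_diff[OF v] by blast
  hence 1: "K2.ge K2.u (F x * F y - F (x * y))"
    using K2.ge_mono u_le_\<delta> K2.ge_commute by (metis add_0)
  have a: "K2.ge 0 a" using v_near_F[OF assms(1,3)] by (simp add: val_ge_def zero_ereal_def)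
  have y: "K2.ge 0 (F y)" using assms by (simp add: val_ge_def v_F zero_ereal_def)
  have "K2.ge K2.u (a * (b - F y) + (a - F x) * F y)"
    using K2.ge_mult0[OF a assms(4)] K2.ge_mult0'[OF assms(3) y] by (rule K2.ge_add)
  hence "K2.ge K2.u (a * b - F x * F y)" by (simp add: algebra_simps)
  thus ?thesis using 1 by (rule K2.ge_diff_trans)
qed

lemma teich_1: "teich 1 1"
proof -
  have "K2.ge (0 + \<delta>) (F 1 - 1)" using F_1 class_diff[of 1 0 "F 1"] by (simp add: K2.v_1 zero_ereal_def)
  hence "K2.ge K2.u (1 - F 1)" using K2.ge_mono u_le_\<delta> K2.ge_commute by (metis add_0)
  thus ?thesis unfolding teich_def
    by (intro exI[of _ "\<lambda>_. 1"]) (simp add: K1.v_1)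
qed

lemma teich_mult: assumes "teich t s" "teich t' s'" shows "teich (t * t') (s * s')"
proof -
  obtain \<tau> \<sigma> where 1: "\<tau> 0 = t" "\<sigma> 0 = s" "\<And>k. \<tau> (Suc k) ^ p = \<tau> k" "\<And>k. \<sigma> (Suc k) ^ p = \<sigma> k"
    "\<And>k. v1 (\<tau> k) = 0" "\<And>k. K2.ge K2.u (\<sigma> k - F (\<tau> k))"
    using assms(1) unfolding teich_def by metis
  obtain \<tau>' \<sigma>' where 2: "\<tau>' 0 = t'" "\<sigma>' 0 = s'" "\<And>k. \<tau>' (Suc k) ^ p = \<tau>' k" "\<And>k. \<sigma>' (Suc k) ^ p = \<sigma>' k"
    "\<And>k. v1 (\<tau>' k) = 0" "\<And>k. K2.ge K2.u (\<sigma>' k - F (\<tau>' k))"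
    using assms(2) unfolding teich_def by metis
  show ?thesis unfolding teich_def
    using 1 2 F_mult_near
    by (intro exI[of _ "\<lambda>k. \<tau> k * \<tau>' k"] exI[of _ "\<lambda>k. \<sigma> k * \<sigma>' k"])
      (simp add: power_mult_distrib K1.mult)
qed

lemma teich_root: assumes "teich t s" shows "\<exists>t' s'. teich t' s' \<and> t' ^ p = t \<and> s' ^ p = s"
proof -
  obtain \<tau> \<sigma> where "\<tau> 0 = t" "\<sigma> 0 = s" and
    *: "\<And>k. \<tau> (Suc k) ^ p = \<tau> k \<and> \<sigma> (Suc k) ^ p = \<sigma> k \<and> v1 (\<tau> k) = 0 \<and>
        K2.ge K2.u (\<sigma> k - F (\<tau> k))"
    using assms unfolding teich_def by metis
  moreover have "teich (\<tau> 1) (\<sigma> 1)" unfolding teich_def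
    using * by (intro exI[of _ "\<lambda>k. \<tau> (Suc k)"] exI[of _ "\<lambda>k. \<sigma> (Suc k)"]) auto
  ultimately show ?thesis by (metis One_nat_def)
qed

lemma teich_root_pk: "teich t s \<Longrightarrow> \<exists>t' s'. teich t' s' \<and> t' ^ (p ^ k) = t \<and> s' ^ (p ^ k) = s"
proof (induction k)
  case (Suc k)
  then obtain t' s' where *: "teich t' s'" "t' ^ (p ^ k) = t" "s' ^ (p ^ k) = s" by blast
  obtain t'' s'' where "teich t'' s''" "t'' ^ p = t'" "s'' ^ p = s'"
    using teich_root[OF *(1)] by blast
  thus ?case using * by (intro exI[of _ t''] exI[of _ s'']) (simp add: power_mult)
qed auto

lemma teich_near_u: "teich t s \<Longrightarrow> K2.ge K2.u (s - F t)"
  unfolding teich_def by metis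

text \<open>
  The congruence modulo the maximal ideal improves to the full precision of \<open>F\<close>: apply it to
  \<open>p ^ m\<close>-th roots and take \<open>p ^ m\<close>-th powers, using that \<open>F\<close> commutes with powers up to classes.
\<close>

lemma teich_near: assumes "teich t s" shows "K2.ge \<delta> (s - F t)"
proof -
  obtain t' s' where *: "teich t' s'" "t' ^ (p ^ m) = t" "s' ^ (p ^ m) = s"
    using teich_root_pk[OF assms] by metis
  have F0: "K2.ge 0 (F t')" using teich_v(1)[OF *(1)] by (simp add: val_ge_def v_F zero_ereal_def)
  have "v2 (F t') = ereal 0" using teich_v(1)[OF *(1)] by (simp add: v_F zero_ereal_def)
  hence v: "v2 (F t' ^ (p ^ m)) = ereal 0" using K2.v_power by fastforce
  have "hclass v2 m (F t) = hclass v2 m (F t' ^ (p ^ m))" using F_power[of t' "p ^ m"] *(2) by simp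
  hence 1: "K2.ge \<delta> (F t' ^ (p ^ m) - F t)" using class_diff[OF v] K2.ge_commute by simp
  have "K2.ge (real (Suc m) * K2.u) (s' ^ (p ^ m) - F t' ^ (p ^ m))"
    using K2.power_pk_contract[OF F0 teich_near_u[OF *(1)]] .
  hence "K2.ge \<delta> (s - F t' ^ (p ^ m))" unfolding *(3)
    by (rule K2.ge_mono) (use K2.u_pos in \<open>simp add: \<delta>_def algebra_simps\<close>)
  thus ?thesis using 1 by (rule K2.ge_diff_trans)
qed

text \<open>
  Successive \<open>p\<close>-th roots in the perfect residue field give the system in \<open>K1\<close>. Its image under \<open>F\<close>
  is a system of approximate \<open>p\<close>-th roots in \<open>K2\<close>, to which the same limit construction applies.
\<close>

lemma teich_exists: assumes x: "v1 x = 0" shows "\<exists>t s. teich t s \<and> K1.ge K1.u (x - t)"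
proof -
  obtain \<rho> where \<rho>: "\<And>x. K1.ge 0 x \<Longrightarrow> K1.ge 0 (\<rho> x)"
    "\<And>x. K1.ge 0 x \<Longrightarrow> K1.ge K1.u (x - \<rho> x ^ p)" using residue_root by metis
  define y where "y k = (\<rho> ^^ k) x" for k
  have y: "y 0 = x" "y (Suc k) = \<rho> (y k)" for k by (simp_all add: y_def)
  have y0: "K1.ge 0 (y k)" for k
    by (induction k) (use x \<rho> in \<open>auto simp: y val_ge_def zero_ereal_def\<close>)
  have "K1.ge K1.u (y (Suc k) ^ p - y k)" for k using \<rho>(2)[OF y0] K1.ge_commute y by metis
  then obtain \<tau> where \<tau>: "\<And>k. \<tau> (Suc k) ^ p = \<tau> k" "\<And>k. K1.ge K1.u (\<tau> k - y k)"
    using K1.coherent_roots[of y] y0 by blast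
  have v\<tau>: "v1 (\<tau> k) = 0" for k
  proof (induction k)
    case 0
    show ?case using K1.v_eq_diff[of x 0 K1.u "\<tau> 0"] \<tau>(2)[of 0] y(1) x K1.ge_commute K1.u_pos
      by (simp add: zero_ereal_def)
  next
    case (Suc k)
    have "\<tau> (Suc k) \<noteq> 0"
      using Suc \<tau>(1)[of k] K1.v_0 K1.p_gt_1 by (auto simp: power_0_left)
    then obtain r where r: "v1 (\<tau> (Suc k)) = ereal r" using K1.v_real by blast
    have "real p * r = 0" using K1.v_power[OF r, of p] \<tau>(1)[of k] Suc by (simp add: zero_ereal_def)
    thus ?case using r K1.p_gt_1 by (simp add: zero_ereal_def)
  qed
  have v0: "v2 (F (\<tau> k)) = ereal 0" for k using v\<tau> by (simp add: v_F zero_ereal_def)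
  have "K2.ge 0 (F (\<tau> k))" for k using v0 by (simp add: K2.ge_iff)
  moreover have "K2.ge K2.u (F (\<tau> (Suc k)) ^ p - F (\<tau> k))" for k
  proof -
    have "hclass v2 m (F (\<tau> (Suc k)) ^ p) = hclass v2 m (F (\<tau> k))"
      using F_power[of "\<tau> (Suc k)" p] \<tau>(1) by simp
    hence "K2.ge \<delta> (F (\<tau> (Suc k)) ^ p - F (\<tau> k))" using class_diff[OF v0] by simp
    thus ?thesis using K2.ge_mono u_le_\<delta> by blast
  qed
  ultimately obtain \<sigma> where \<sigma>: "\<And>k. \<sigma> (Suc k) ^ p = \<sigma> k" "\<And>k. K2.ge K2.u (\<sigma> k - F (\<tau> k))"
    using K2.coherent_roots[of "\<lambda>k. F (\<tau> k)"] by blast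
  have "teich (\<tau> 0) (\<sigma> 0)" unfolding teich_def using \<tau> \<sigma> v\<tau> by blast
  moreover have "K1.ge K1.u (x - \<tau> 0)" using \<tau>(2)[of 0] y(1) K1.ge_commute by simp
  ultimately show ?thesis by blast
qed

section \<open>Additive relations between Teichmueller elements\<close>

text \<open>
  A subring of the product \<open>K1 \<times> K2\<close>. To show that it is the graph of a ring
  homomorphism, additive relations between Teichmueller elements of \<open>K1\<close> have to be transported to
  \<open>K2\<close>. Working in the product treats both fields by the same polynomial identities.
\<close>

inductive teich_ring :: "'a \<Rightarrow> 'b \<Rightarrow> bool" where
  gen: "teich t s \<Longrightarrow> teich_ring t s"
| add: "teich_ring x y \<Longrightarrow> teich_ring x' y' \<Longrightarrow> teich_ring (x + x') (y + y')"
| minus: "teich_ring x y \<Longrightarrow> teich_ring (- x) (- y)"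
| mult: "teich_ring x y \<Longrightarrow> teich_ring x' y' \<Longrightarrow> teich_ring (x * x') (y * y')"

lemma teich_ring_1: "teich_ring 1 1" by (intro gen teich_1)

lemma teich_ring_0: "teich_ring 0 0"
  using teich_ring.add[OF teich_ring_1 teich_ring.minus[OF teich_ring_1]] by simp

lemma teich_ring_diff: "teich_ring x y \<Longrightarrow> teich_ring x' y' \<Longrightarrow> teich_ring (x - x') (y - y')"
  using teich_ring.add[OF _ teich_ring.minus, of x y x' y'] by simp

lemma teich_ring_power: "teich_ring x y \<Longrightarrow> teich_ring (x ^ k) (y ^ k)"
  by (induction k) (auto intro: teich_ring_1 teich_ring.mult)

lemma teich_ring_of_nat: "teich_ring (of_nat k) (of_nat k)"
  by (induction k) (auto intro: teich_ring_1 teich_ring_0 teich_ring.add)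

lemma teich_ring_sum: "(\<And>i. i \<in> A \<Longrightarrow> teich_ring (f i) (g i)) \<Longrightarrow> teich_ring (sum f A) (sum g A)"
  by (induction A rule: infinite_finite_induct) (auto intro: teich_ring_0 teich_ring.add)

text \<open>
  Modulo the maximal ideal \<open>F\<close> is a ring homomorphism, so the claim propagates from the generators.
\<close>

lemma teich_ring_near:
  "teich_ring x y \<Longrightarrow> K1.ge 0 x \<and> K2.ge 0 y \<and> K2.ge K2.u (y - F x)"
proof (induction rule: teich_ring.induct)
  case (gen t s)
  thus ?case using teich_v teich_near_u by (simp add: val_ge_def zero_ereal_def)
next
  case (add x y x' y')
  have "K2.ge (0 + real m * K2.u) (F (x + x') - (F x + F x'))" using add by (intro F_add) auto
  hence "K2.ge K2.u (F x + F x' - F (x + x'))"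
    using K2.ge_mono u_le_\<delta> K2.ge_commute unfolding \<delta>_def by (metis add_0)
  moreover have "K2.ge K2.u ((y - F x) + (y' - F x'))" using add by (intro K2.ge_add) auto
  hence "K2.ge K2.u ((y + y') - (F x + F x'))" by (simp add: algebra_simps)
  ultimately have "K2.ge K2.u ((y + y') - F (x + x'))" using K2.ge_diff_trans by blast
  thus ?case using add K1.ge_add K2.ge_add by blast
next
  case (minus x y)
  have "K2.ge (0 + real m * K2.u) (F (x + - x) - (F x + F (- x)))" using minus by (intro F_add) auto
  hence "K2.ge K2.u (F x + F (- x))"
    using K2.ge_mono u_le_\<delta> K2.ge_minus_iff unfolding \<delta>_def
    by (metis add_0 F_0 add.right_inverse diff_0)
  moreover have "K2.ge K2.u (y - F x)" using minus by blast
  ultimately have "K2.ge K2.u (- ((y - F x) + (F x + F (- x))))"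
    using K2.ge_add K2.ge_minus_iff by blast
  thus ?case using minus by (simp add: algebra_simps)
next
  case (mult x y x' y')
  have "K2.ge K2.u (y * y' - F (x * x'))"
  proof -
    have Fx': "K2.ge 0 (F x')" using mult by (simp add: ge_F)
    have "K2.ge K2.u (y * (y' - F x') + (y - F x) * F x')"
      using mult Fx' by (intro K2.ge_add K2.ge_mult0 K2.ge_mult0') auto
    hence 1: "K2.ge K2.u (y * y' - F x * F x')" by (simp add: algebra_simps)
    have "K2.ge K2.u (F x * F x' - F (x * x'))"
    proof (cases "x = 0 \<or> x' = 0")
      case True thus ?thesis by (auto simp: F_0)
    next
      case False
      then obtain r r' where r: "v1 x = ereal r" "v1 x' = ereal r'" using K1.v_real by blast
      have r0: "r \<ge> 0" "r' \<ge> 0" using mult r by (simp_all add: K1.ge_iff)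
      have v: "v2 (F x * F x') = ereal (r + r')" using r by (simp add: K2.mult v_F)
      have "K2.ge (r + r' + \<delta>) (F (x * x') - F x * F x')" using F_mult class_diff[OF v] by blast
      hence "K2.ge K2.u (F (x * x') - F x * F x')"
        by (rule K2.ge_mono) (use r0 u_le_\<delta> in linarith)
      thus ?thesis using K2.ge_commute by blast
    qed
    with 1 show ?thesis by (rule K2.ge_diff_trans)
  qed
  thus ?case using mult K1.ge_mult0 K2.ge_mult0 by blast
qed

lemma add_power_pair:
  assumes "teich_ring a b" "teich_ring a' b'"
  shows "\<exists>c d. teich_ring c d \<and> (a + a') ^ p = a ^ p + a' ^ p + of_nat p * c \<and>
    (b + b') ^ p = b ^ p + b' ^ p + of_nat p * d"
proof (intro exI conjI)
  show "(a + a') ^ p = a ^ p + a' ^ p + of_nat p *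
      (\<Sum>i\<in>{1..<p}. of_nat ((p choose i) div p) * a ^ i * a' ^ (p - i))"
    by (rule add_power_prime[OF K1.prime_p])
  show "(b + b') ^ p = b ^ p + b' ^ p + of_nat p *
      (\<Sum>i\<in>{1..<p}. of_nat ((p choose i) div p) * b ^ i * b' ^ (p - i))"
    by (rule add_power_prime[OF K1.prime_p])
  show "teich_ring (\<Sum>i\<in>{1..<p}. of_nat ((p choose i) div p) * a ^ i * a' ^ (p - i))
     (\<Sum>i\<in>{1..<p}. of_nat ((p choose i) div p) * b ^ i * b' ^ (p - i))"
    using assms by (intro teich_ring_sum teich_ring.mult teich_ring_of_nat teich_ring_power)
qed

text \<open>
  On generators there is nothing to correct, since Teichmueller pairs have \<open>p\<close>-th roots that are
  again Teichmueller pairs; and \<open>p\<close>-th powers are additive and multiplicative modulo \<open>p\<close>.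
\<close>

lemma pth_power_mod_p:
  "teich_ring x y \<Longrightarrow> \<exists>a b c d. teich_ring a b \<and> teich_ring c d \<and>
     x = a ^ p + of_nat p * c \<and> y = b ^ p + of_nat p * d"
proof (induction rule: teich_ring.induct)
  case (gen t s)
  then obtain t' s' where "teich t' s'" "t' ^ p = t" "s' ^ p = s" using teich_root by blast
  thus ?case using teich_ring_0 teich_ring.gen
    by (intro exI[of _ t'] exI[of _ s'] exI[of _ 0]) simp
next
  case (add x y x' y')
  obtain a b c d where 1: "teich_ring a b" "teich_ring c d"
    "x = a ^ p + of_nat p * c" "y = b ^ p + of_nat p * d" using add by metis
  obtain a' b' c' d' where 2: "teich_ring a' b'" "teich_ring c' d'"
    "x' = a' ^ p + of_nat p * c'" "y' = b' ^ p + of_nat p * d'" using add by metis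
  obtain f g where 3: "teich_ring f g" "(a + a') ^ p = a ^ p + a' ^ p + of_nat p * f"
    "(b + b') ^ p = b ^ p + b' ^ p + of_nat p * g" using add_power_pair[OF 1(1) 2(1)] by metis
  show ?case
  proof (intro exI conjI)
    show "teich_ring (a + a') (b + b')" using 1 2 by (intro teich_ring.add)
    show "teich_ring (c + c' - f) (d + d' - g)" using 1 2 3
      by (intro teich_ring.add teich_ring_diff)
    show "x + x' = (a + a') ^ p + of_nat p * (c + c' - f)"
      unfolding 1 2 3 by (simp add: algebra_simps)
    show "y + y' = (b + b') ^ p + of_nat p * (d + d' - g)"
      unfolding 1 2 3 by (simp add: algebra_simps)
  qed
next
  case (minus x y)
  obtain a b c d where 1: "teich_ring a b" "teich_ring c d"
    "x = a ^ p + of_nat p * c" "y = b ^ p + of_nat p * d" using minus by metis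
  have ab: "teich_ring (- a) (- b)" using 1 by (intro teich_ring.minus)
  \<comment> \<open>Expanding \<open>0 = (a + - a) ^ p\<close> treats odd \<open>p\<close> and \<open>p = 2\<close> uniformly.\<close>
  obtain f g where 3: "teich_ring f g" "(a + - a) ^ p = a ^ p + (- a) ^ p + of_nat p * f"
    "(b + - b) ^ p = b ^ p + (- b) ^ p + of_nat p * g" using add_power_pair[OF 1(1) ab] by metis
  have p0: "p > 0" using K1.p_gt_1 by simp
  have "a ^ p + ((- a) ^ p + of_nat p * f) = 0" "b ^ p + ((- b) ^ p + of_nat p * g) = 0"
    using 3(2,3) p0 by (simp_all add: power_0_left add.assoc)
  hence 4: "- (a ^ p) = (- a) ^ p + of_nat p * f" "- (b ^ p) = (- b) ^ p + of_nat p * g"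
    using minus_unique by blast+
  show ?case
  proof (intro exI conjI)
    show "teich_ring (- a) (- b)" by (rule ab)
    show "teich_ring (f - c) (g - d)" using 1 3 by (intro teich_ring_diff)
    show "- x = (- a) ^ p + of_nat p * (f - c)"
      using 4 unfolding 1 by (simp add: algebra_simps)
    show "- y = (- b) ^ p + of_nat p * (g - d)"
      using 4 unfolding 1 by (simp add: algebra_simps)
  qed
next
  case (mult x y x' y')
  obtain a b c d where 1: "teich_ring a b" "teich_ring c d"
    "x = a ^ p + of_nat p * c" "y = b ^ p + of_nat p * d" using mult by metis
  obtain a' b' c' d' where 2: "teich_ring a' b'" "teich_ring c' d'"
    "x' = a' ^ p + of_nat p * c'" "y' = b' ^ p + of_nat p * d'" using mult by metis
  show ?case
  proof (intro exI conjI)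
    show "teich_ring (a * a') (b * b')" using 1 2 by (intro teich_ring.mult)
    show "teich_ring (a ^ p * c' + c * a' ^ p + of_nat p * (c * c'))
        (b ^ p * d' + d * b' ^ p + of_nat p * (d * d'))"
      using 1 2 by (intro teich_ring.add teich_ring.mult teich_ring_power teich_ring_of_nat)
    show "x * x' = (a * a') ^ p + of_nat p * (a ^ p * c' + c * a' ^ p + of_nat p * (c * c'))"
      unfolding 1 2 by (simp add: algebra_simps power_mult_distrib)
    show "y * y' = (b * b') ^ p + of_nat p * (b ^ p * d' + d * b' ^ p + of_nat p * (d * d'))"
      unfolding 1 2 by (simp add: algebra_simps power_mult_distrib)
  qed
qed

lemma power_shift_p:
  assumes "teich_ring a b" "teich_ring c d"
  shows "\<exists>f g. teich_ring f g \<and> (a + of_nat p * c) ^ n = a ^ n + of_nat p * f \<and>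
     (b + of_nat p * d) ^ n = b ^ n + of_nat p * g"
proof (induction n)
  case 0 show ?case using teich_ring_0 by (intro exI[of _ 0]) simp
next
  case (Suc n)
  then obtain f g where 1: "teich_ring f g" "(a + of_nat p * c) ^ n = a ^ n + of_nat p * f"
     "(b + of_nat p * d) ^ n = b ^ n + of_nat p * g" by blast
  show ?case
  proof (intro exI conjI)
    show "teich_ring (a * f + c * a ^ n + of_nat p * (c * f)) (b * g + d * b ^ n + of_nat p * (d * g))"
      using 1 assms by (intro teich_ring.add teich_ring.mult teich_ring_power teich_ring_of_nat)
    show "(a + of_nat p * c) ^ Suc n =
       a ^ Suc n + of_nat p * (a * f + c * a ^ n + of_nat p * (c * f))"
      unfolding power_Suc 1 by (simp add: algebra_simps)
    show "(b + of_nat p * d) ^ Suc n =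
       b ^ Suc n + of_nat p * (b * g + d * b ^ n + of_nat p * (d * g))"
      unfolding power_Suc 1 by (simp add: algebra_simps)
  qed
qed

lemma pk_power_mod_p:
  "teich_ring x y \<Longrightarrow> \<exists>a b c d. teich_ring a b \<and> teich_ring c d \<and>
     x = a ^ (p ^ k) + of_nat p * c \<and> y = b ^ (p ^ k) + of_nat p * d"
proof (induction k)
  case 0
  show ?case using 0 teich_ring_0 by (intro exI[of _ x] exI[of _ y] exI[of _ 0]) simp
next
  case (Suc k)
  obtain a b c d where 1: "teich_ring a b" "teich_ring c d"
     "x = a ^ (p ^ k) + of_nat p * c" "y = b ^ (p ^ k) + of_nat p * d" using Suc by metis
  obtain a' b' c' d' where 2: "teich_ring a' b'" "teich_ring c' d'"
     "a = a' ^ p + of_nat p * c'" "b = b' ^ p + of_nat p * d'" using pth_power_mod_p[OF 1(1)] by metis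
  obtain f g where 3: "teich_ring f g" "a ^ (p ^ k) = (a' ^ p) ^ (p ^ k) + of_nat p * f"
     "b ^ (p ^ k) = (b' ^ p) ^ (p ^ k) + of_nat p * g"
    using power_shift_p[OF teich_ring_power[OF 2(1)] 2(2), of p "p ^ k"] 2(3,4) by metis
  show ?case
  proof (intro exI conjI)
    show "teich_ring a' b'" by (rule 2)
    show "teich_ring (f + c) (g + d)" using 1 3 by (intro teich_ring.add)
    show "x = a' ^ (p ^ Suc k) + of_nat p * (f + c)"
      unfolding 1(3) 3 by (simp add: power_mult algebra_simps)
    show "y = b' ^ (p ^ Suc k) + of_nat p * (g + d)"
      unfolding 1(4) 3 by (simp add: power_mult algebra_simps)
  qed
qed

lemma large_pk: "\<exists>k. r \<le> real (p ^ k)"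
proof -
  obtain k :: nat where "r < real k" using reals_Archimedean2 by blast
  moreover have "k < p ^ k" using K1.p_gt_1 power_gt_expt[of p k] by simp
  ultimately have "r \<le> real (p ^ k)" by linarith
  thus ?thesis by blast
qed

lemma teich_ring_pos_pair:
  assumes "teich_ring x y" "K1.ge K1.u x" shows "K2.ge K2.u y"
proof -
  have "K2.ge K1.u (F x)" using assms ge_F by blast
  hence "K2.ge K2.u (F x)" using K2.ge_pos K1.u_pos by blast
  moreover have "K2.ge K2.u (y - F x)" using teich_ring_near assms by blast
  ultimately show ?thesis using K2.ge_shift by blast
qed

text \<open>
  Although \<open>K1\<close> and \<open>K2\<close> may be ramified, elements of this ring cannot have values strictly between 0
  and 1: up to a multiple of \<open>p\<close> such an element is a \<open>p ^ k\<close>-th power of an element of positive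
  value, and \<open>k\<close> is arbitrary. Positivity itself passes from \<open>K1\<close> to \<open>K2\<close> because \<open>F\<close> preserves values.
\<close>

lemma teich_ring_pos:
  assumes xy: "teich_ring x y" and x: "K1.ge K1.u x"
  shows "K1.ge 1 x \<and> K2.ge 1 y"
proof -
  obtain k where k: "max (1 / K1.u) (1 / K2.u) \<le> real (p ^ k)" using large_pk by blast
  obtain a b c d where 1: "teich_ring a b" "teich_ring c d"
     "x = a ^ (p ^ k) + of_nat p * c" "y = b ^ (p ^ k) + of_nat p * d"
    using pk_power_mod_p[OF xy] by metis
  have c: "K1.ge 1 (of_nat p * c)" "K2.ge 1 (of_nat p * d)"
    using teich_ring_near[OF 1(2)] K1.ge_mult0'[OF K1.ge_p] K2.ge_mult0'[OF K2.ge_p] by blast+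
  have "K1.ge K1.u (x - of_nat p * c)"
    using x K1.ge_mono[OF c(1) K1.u_le_1] by (rule K1.ge_diff)
  hence "K1.ge K1.u (a ^ (p ^ k))" using 1 by simp
  hence a: "K1.ge K1.u a" by (rule K1.ge_power_pos)
  have b: "K2.ge K2.u b" using teich_ring_pos_pair[OF 1(1) a] .
  have "1 \<le> real (p ^ k) * K1.u" "1 \<le> real (p ^ k) * K2.u"
    using k K1.u_pos K2.u_pos by (simp_all add: field_simps)
  hence "K1.ge 1 (a ^ (p ^ k))" "K2.ge 1 (b ^ (p ^ k))"
    using K1.ge_mono[OF K1.ge_power[OF a]] K2.ge_mono[OF K2.ge_power[OF b]] by blast+
  thus ?thesis unfolding 1 using c K1.ge_add K2.ge_add by blast
qed

text \<open>
  The transport of relations. Write the pair as a \<open>p ^ k\<close>-th power plus \<open>p\<close> times another pair. The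
  base of the power has value at least 1 in both fields, so for large \<open>k\<close> the power is negligible in
  both, and the induction hypothesis applies to the cofactor of \<open>p\<close>. This replaces the addition
  polynomials of Witt vectors.
\<close>

lemma teich_ring_step:
  "teich_ring x y \<Longrightarrow> K1.ge r x \<Longrightarrow> r > real N \<Longrightarrow>
     K1.ge (real (Suc N)) x \<and> K2.ge (real (Suc N)) y"
proof (induction N arbitrary: x y r)
  case 0
  thus ?case using teich_ring_pos K1.ge_pos by simp
next
  case (Suc N)
  obtain k where k: "real (Suc (Suc N)) \<le> real (p ^ k)" using large_pk by blast
  obtain a b c d where 1: "teich_ring a b" "teich_ring c d"
     "x = a ^ (p ^ k) + of_nat p * c" "y = b ^ (p ^ k) + of_nat p * d"
    using pk_power_mod_p[OF Suc.prems(1)] by metis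
  have c: "K1.ge 1 (of_nat p * c)"
    using teich_ring_near[OF 1(2)] K1.ge_mult0'[OF K1.ge_p] by blast
  have x: "K1.ge K1.u x" using K1.ge_pos[OF Suc.prems(2)] Suc.prems(3) by simp
  have "K1.ge K1.u (x - of_nat p * c)"
    using x K1.ge_mono[OF c K1.u_le_1] by (rule K1.ge_diff)
  hence "K1.ge K1.u (a ^ (p ^ k))" using 1 by simp
  hence "K1.ge K1.u a" by (rule K1.ge_power_pos)
  hence ab: "K1.ge 1 a" "K2.ge 1 b" using teich_ring_pos[OF 1(1)] by blast+
  have pow: "K1.ge (real (Suc (Suc N))) (a ^ (p ^ k))" "K2.ge (real (Suc (Suc N))) (b ^ (p ^ k))"
    using K1.ge_mono[OF K1.ge_power[OF ab(1)]] K2.ge_mono[OF K2.ge_power[OF ab(2)]] k by simp_all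
  \<comment> \<open>Strictly above \<open>N + 1\<close>, so that the strict bound survives the division by \<open>p\<close>.\<close>
  define r' where "r' = min r (real (Suc (Suc N)))"
  have "K1.ge r' (x - a ^ (p ^ k))"
    by (intro K1.ge_diff K1.ge_mono[OF Suc.prems(2)] K1.ge_mono[OF pow(1)]) (auto simp: r'_def)
  hence "K1.ge (1 + (r' - 1)) (of_nat p * c)" using 1 by simp
  hence "K1.ge (r' - 1) c" using K1.ge_scale[OF K1.v_p] by blast
  moreover have "r' - 1 > real N" using Suc.prems(3) by (simp add: r'_def)
  ultimately have "K1.ge (real (Suc N)) c" "K2.ge (real (Suc N)) d" using Suc.IH[OF 1(2)] by blast+
  hence "K1.ge (1 + real (Suc N)) (of_nat p * c)" "K2.ge (1 + real (Suc N)) (of_nat p * d)"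
    using K1.ge_scale[OF K1.v_p] K2.ge_scale[OF K2.v_p] by blast+
  thus ?case unfolding 1 using pow K1.ge_add K2.ge_add by simp
qed

lemma teich_ring_transfer:
  assumes "teich_ring x y" "K1.ge r x" shows "K2.ge r y"
proof (cases "r \<le> 0")
  case True
  thus ?thesis using teich_ring_near[OF assms(1)] K2.ge_mono by blast
next
  case False
  \<comment> \<open>The integer with \<open>N < r \<le> N + 1\<close>.\<close>
  define N where "N = nat (\<lceil>r\<rceil> - 1)"
  have "real N < r" "r \<le> real (Suc N)" unfolding N_def using False by linarith+
  thus ?thesis using teich_ring_step[OF assms] K2.ge_mono by blast
qed

lemma teich_ring_integral_value:
  assumes "teich_ring x y" "x \<noteq> 0" shows "\<exists>n::nat. v1 x = ereal (real n)"
proof -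
  obtain r where r: "v1 x = ereal r" using K1.v_real assms by blast
  have r0: "r \<ge> 0" using teich_ring_near[OF assms(1)] r by (simp add: K1.ge_iff)
  define N where "N = nat \<lfloor>r\<rfloor>"
  have N: "real N \<le> r" "r < real (Suc N)" unfolding N_def using r0 by linarith+
  have "\<not> r > real N"
  proof
    assume "r > real N"
    hence "K1.ge (real (Suc N)) x" using teich_ring_step[OF assms(1), of r] r by (simp add: K1.ge_iff)
    thus False using N r by (simp add: K1.ge_iff)
  qed
  thus ?thesis using N r by (intro exI[of _ N]) simp
qed

section \<open>Matching uniformizers\<close>

text \<open>
  For any uniformizer the quotient of its \<open>e\<close>-th power by \<open>p\<close> is a unit, which is a Teichmueller
  element \<open>\<theta>\<close> times an element near 1. The latter has an \<open>e\<close>-th root, since \<open>p\<close> does not divide \<open>e\<close>, so the uniformizer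
  can be changed to satisfy \<open>\<pi> ^ e = p \<theta>\<close> exactly. As \<open>F\<close> fixes the class of \<open>p\<close>, the element \<open>F \<pi>\<close>
  satisfies the corresponding equation in \<open>K2\<close> up to a class, and an \<open>e\<close>-th root corrects it.
\<close>

lemma uniformizer_pair_exists:
  "\<exists>\<pi> \<omega> \<theta> \<eta>. teich \<theta> \<eta> \<and> v1 \<pi> = ereal K1.u \<and> \<pi> ^ K1.e = of_nat p * \<theta> \<and>
     \<omega> ^ K1.e = of_nat p * \<eta> \<and> K2.ge (K1.u + \<delta>) (\<omega> - F \<pi>)"
proof -
  obtain \<pi>0 where \<pi>0: "v1 \<pi>0 = ereal K1.u" using K1.ex_v[of 1] by auto
  have v\<pi>0e: "v1 (\<pi>0 ^ K1.e) = ereal 1" using K1.v_power[OF \<pi>0, of K1.e] K1.e_u by simp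
  define x where "x = \<pi>0 ^ K1.e / of_nat p"
  have vx: "v1 x = ereal 0" unfolding x_def using K1.v_divide[OF v\<pi>0e K1.v_p] by simp
  obtain \<theta> \<eta> where \<theta>: "teich \<theta> \<eta>" "K1.ge K1.u (x - \<theta>)"
    using teich_exists[of x] vx by (auto simp: zero_ereal_def)
  have x0: "x \<noteq> 0" using K1.v_nz[OF vx] .
  have "x * (\<theta> / x - 1) = \<theta> - x" using x0 by (simp add: right_diff_distrib)
  hence "K1.ge (0 + K1.u) (x * (\<theta> / x - 1))" using \<theta>(2) K1.ge_commute by simp
  hence "K1.ge K1.u (\<theta> / x - 1)" using K1.ge_scale[OF vx] by blast
  then obtain r where r: "r ^ K1.e = \<theta> / x" "K1.ge K1.u (r - 1)"
    using K1.tame_root[OF tame K1.u_pos] by blast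
  define \<pi> where "\<pi> = \<pi>0 * r"
  have "v1 r = ereal 0" using K1.v_eq_diff[of 1 0 K1.u r] r(2) K1.ge_commute K1.u_pos
    by (simp add: K1.v_1 zero_ereal_def)
  hence v\<pi>: "v1 \<pi> = ereal K1.u" unfolding \<pi>_def using K1.v_mult[OF \<pi>0] by fastforce
  have "\<pi> ^ K1.e = (of_nat p * x) * (\<theta> / x)"
    unfolding \<pi>_def power_mult_distrib r(1) x_def using K1.p_nz by simp
  hence \<pi>e: "\<pi> ^ K1.e = of_nat p * \<theta>" using x0 by simp
  define y where "y = F \<pi>"
  have vy: "v2 y = ereal K1.u" using v\<pi> by (simp add: y_def v_F)
  have vye: "v2 (y ^ K1.e) = ereal 1" using K2.v_power[OF vy, of K1.e] K1.e_u by simp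
  have v\<eta>: "v2 (F \<theta>) = ereal 0" "v2 \<eta> = ereal 0" using teich_v[OF \<theta>(1)] by (simp_all add: v_F zero_ereal_def)
  have \<eta>: "hclass v2 m \<eta> = hclass v2 m (F \<theta>)"
    using class_diff[OF v\<eta>(1)] teich_near[OF \<theta>(1)] by simp
  have "hclass v2 m (y ^ K1.e) = hclass v2 m (F (of_nat p * \<theta>))"
    using F_power[of \<pi> K1.e] by (simp add: y_def \<pi>e)
  also have "\<dots> = hclass v2 m (F (of_nat p) * F \<theta>)" by (rule F_mult)
  also have "\<dots> = hclass v2 m (of_nat p * \<eta>)"
    by (rule K2.hclass_mult[OF m_pos F_p]) (simp add: \<eta>)
  finally have "K2.ge (1 + \<delta>) (of_nat p * \<eta> - y ^ K1.e)"
    using class_diff[OF vye] by metis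
  moreover have y0: "y ^ K1.e \<noteq> 0" using K2.v_nz[OF vye] .
  ultimately have "K2.ge (1 + \<delta>) (y ^ K1.e * (of_nat p * \<eta> / y ^ K1.e - 1))"
    by (simp add: right_diff_distrib)
  hence "K2.ge \<delta> (of_nat p * \<eta> / y ^ K1.e - 1)" using K2.ge_scale[OF vye] by blast
  then obtain r' where r': "r' ^ K1.e = of_nat p * \<eta> / y ^ K1.e" "K2.ge \<delta> (r' - 1)"
    using K2.tame_root[OF tame \<delta>_pos] by blast
  have "(y * r') ^ K1.e = of_nat p * \<eta>" unfolding power_mult_distrib r'(1) using y0 by simp
  moreover have "K2.ge (K1.u + \<delta>) (y * (r' - 1))" using K2.ge_scale[OF vy] r'(2) by blast
  hence "K2.ge (K1.u + \<delta>) (y * r' - F \<pi>)" by (simp add: y_def algebra_simps)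
  ultimately show ?thesis using \<theta>(1) v\<pi> \<pi>e by blast
qed

end

text \<open>
  If summands have pairwise distinct values, no cancellation occurs, so a bound for the sum bounds
  every summand.
\<close>

lemma (in mixed_char_discrete_valuation) ge_summand:
  assumes A: "finite A" and sum: "ge r (sum f A)"
    and distinct: "\<And>i j. i \<in> A \<Longrightarrow> j \<in> A \<Longrightarrow> f i \<noteq> 0 \<Longrightarrow> v (f i) = v (f j) \<Longrightarrow> i = j"
    and k: "k \<in> A"
  shows "ge r (f k)"
proof (rule ccontr)
  assume "\<not> ge r (f k)"
  define B where "B = {i \<in> A. \<not> ge r (f i)}"
  have B: "finite B" "B \<noteq> {}" using A k \<open>\<not> ge r (f k)\<close> by (auto simp: B_def)
  have "Min ((\<lambda>i. v (f i)) ` B) \<in> (\<lambda>i. v (f i)) ` B" using B by (intro Min_in) auto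
  then obtain i where i: "i \<in> B" "v (f i) = Min ((\<lambda>i. v (f i)) ` B)" by auto
  have min: "v (f i) \<le> v (f j)" if "j \<in> B" for j using B that i(2) by simp
  have fi: "f i \<noteq> 0" using i(1) by (auto simp: B_def)
  then obtain a :: int where a: "v (f i) = ereal (u * real_of_int a)" using v_u by blast
  define s where "s = (real_of_int a + 1) * u"
  have ra: "r > real_of_int a * u" using i(1) by (simp add: B_def ge_iff[OF a] mult.commute)
  have "ge s (f j)" if j: "j \<in> A - {i}" for j
  proof (cases "f j = 0")
    case False
    obtain b where b: "v (f j) = ereal b" using v_real False by blast
    have "v (f i) \<noteq> v (f j)" using distinct[of i j] i(1) j fi by (auto simp: B_def)
    hence "b > real_of_int a * u"
    proof (cases "j \<in> B")
      case True
      with min[OF this] \<open>v (f i) \<noteq> v (f j)\<close> show ?thesis by (simp add: a b mult.commute)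
    next
      case False
      thus ?thesis using j ra by (simp add: B_def ge_iff[OF b])
    qed
    thus ?thesis unfolding s_def using ge_discrete[of b "f j" a] by (simp add: ge_iff[OF b])
  qed simp
  hence "ge s (sum f (A - {i}))" by (rule ge_sum)
  moreover have "ge s (sum f A)" unfolding s_def by (rule ge_discrete[OF sum ra])
  moreover have "f i = sum f A - sum f (A - {i})" using A i(1) by (simp add: sum_diff1 B_def)
  ultimately have "ge s (f i)" using ge_diff by metis
  thus False using u_pos by (simp add: ge_iff[OF a] s_def algebra_simps)
qed

locale hyperfield_lift_uniformizers = hyperfield_lift v1 v2 p F m
  for v1 :: "'a::field_char_0 \<Rightarrow> ereal" and v2 :: "'b::field_char_0 \<Rightarrow> ereal" and p F m +
  fixes \<pi> \<theta> :: 'a and \<omega> \<eta> :: 'b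
  assumes teich_unit: "teich \<theta> \<eta>"
    and v_\<pi>: "v1 \<pi> = ereal K1.u"
    and \<pi>_e: "\<pi> ^ K1.e = of_nat p * \<theta>"
    and \<omega>_e: "\<omega> ^ K1.e = of_nat p * \<eta>"
    and \<omega>_near: "K2.ge (K1.u + \<delta>) (\<omega> - F \<pi>)"
begin

lemma v_\<omega>: "v2 \<omega> = ereal K1.u"
  using K2.v_eq_diff[of "F \<pi>" K1.u "K1.u + \<delta>" \<omega>] \<omega>_near K2.ge_commute \<delta>_pos v_\<pi> by (simp add: v_F)

lemma v_monomial:
  assumes "teich t s"
  shows "v1 (t * \<pi> ^ i / of_nat p ^ N) = ereal (real i * K1.u - real N)"
    and "v2 (s * \<omega> ^ i / of_nat p ^ N) = ereal (real i * K1.u - real N)"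
proof -
  have t: "v1 t = ereal 0" "v2 s = ereal 0" using teich_v[OF assms] by (simp_all add: zero_ereal_def)
  show "v1 (t * \<pi> ^ i / of_nat p ^ N) = ereal (real i * K1.u - real N)"
    using K1.v_divide[OF K1.v_mult[OF t(1) K1.v_power[OF v_\<pi>]] K1.v_power[OF K1.v_p]] by simp
  show "v2 (s * \<omega> ^ i / of_nat p ^ N) = ereal (real i * K1.u - real N)"
    using K2.v_divide[OF K2.v_mult[OF t(2) K2.v_power[OF v_\<omega>]] K2.v_power[OF K2.v_p]] by simp
qed

text \<open>
  On monomials multiplicativity of \<open>F\<close> up to classes suffices; the denominator is handled by
  multiplying with \<open>p ^ N\<close>, whose class is fixed by \<open>F\<close>.
\<close>

lemma monomial_near:
  assumes ts: "teich t s" and r: "v1 (t * \<pi> ^ i / of_nat p ^ N) = ereal r"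
  shows "K2.ge (r + \<delta>) (s * \<omega> ^ i / of_nat p ^ N - F (t * \<pi> ^ i / of_nat p ^ N))"
proof -
  note hm = K2.hclass_mult[OF m_pos] and hp = K2.hclass_power[OF m_pos]
  define x where "x = t * \<pi> ^ i / of_nat p ^ N"
  have pN: "(of_nat p ^ N :: 'a) \<noteq> 0" "(of_nat p ^ N :: 'b) \<noteq> 0"
    using K1.p_nz K2.p_nz by simp_all
  have "v2 (F t) = ereal 0" using teich_v[OF ts] by (simp add: v_F zero_ereal_def)
  hence s: "hclass v2 m (F t) = hclass v2 m s"
    using class_diff[of "F t" 0 s] teich_near[OF ts] by simp
  have "v2 (F \<pi>) = ereal K1.u" by (simp add: v_F v_\<pi>)
  hence \<omega>: "hclass v2 m (F \<pi>) = hclass v2 m \<omega>" using class_diff[of "F \<pi>" K1.u \<omega>] \<omega>_near by simp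
  have "hclass v2 m (F x * of_nat p ^ N) = hclass v2 m (F x * F (of_nat p) ^ N)"
    by (rule hm[OF refl hp]) (simp add: F_p)
  also have "\<dots> = hclass v2 m (F x * F (of_nat p ^ N))"
    by (rule hm[OF refl]) (simp add: F_power)
  also have "\<dots> = hclass v2 m (F (x * of_nat p ^ N))" by (simp only: F_mult)
  also have "x * of_nat p ^ N = t * \<pi> ^ i" using pN by (simp add: x_def)
  also have "hclass v2 m (F (t * \<pi> ^ i)) = hclass v2 m (F t * F (\<pi> ^ i))" by (rule F_mult)
  also have "\<dots> = hclass v2 m (s * F \<pi> ^ i)" by (rule hm[OF s F_power])
  also have "\<dots> = hclass v2 m (s * \<omega> ^ i)" by (rule hm[OF refl hp[OF \<omega>]])
  finally have eq: "hclass v2 m (F x * of_nat p ^ N) = hclass v2 m (s * \<omega> ^ i)" .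
  have r': "r = real i * K1.u - real N" using r v_monomial(1)[OF ts] by simp
  have "v2 (s * \<omega> ^ i) = ereal (real N + r)" using v_monomial(2)[OF ts, of i 0] r' by simp
  hence "K2.ge (real N + r + \<delta>) (F x * of_nat p ^ N - s * \<omega> ^ i)" using class_diff eq by blast
  hence "K2.ge (real N + r + \<delta>) (s * \<omega> ^ i - F x * of_nat p ^ N)" using K2.ge_commute by blast
  also have "s * \<omega> ^ i - F x * of_nat p ^ N = of_nat p ^ N * (s * \<omega> ^ i / of_nat p ^ N - F x)"
    using pN by (simp add: right_diff_distrib mult.commute)
  finally have "K2.ge (real N + (r + \<delta>)) (of_nat p ^ N * (s * \<omega> ^ i / of_nat p ^ N - F x))"
    by (simp add: add.assoc)
  moreover have "v2 (of_nat p ^ N) = ereal (real N)" using K2.v_power[OF K2.v_p, of N] by simp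
  ultimately show ?thesis unfolding x_def[symmetric] using K2.ge_scale by blast
qed

section \<open>Monomials and their additive span\<close>

text \<open>
  The additive group generated by pairs of corresponding monomials. Products of monomials are
  monomials, so it is a subring of \<open>K1 \<times> K2\<close>; its first projection is dense in \<open>K1\<close>.
\<close>

inductive span :: "'a \<Rightarrow> 'b \<Rightarrow> bool" where
  gen: "teich t s \<Longrightarrow> span (t * \<pi> ^ i / of_nat p ^ N) (s * \<omega> ^ i / of_nat p ^ N)"
| add: "span x y \<Longrightarrow> span x' y' \<Longrightarrow> span (x + x') (y + y')"
| minus: "span x y \<Longrightarrow> span (- x) (- y)"

lemma span_1: "span 1 1" using span.gen[OF teich_1, of 0 0] by simp

lemma span_0: "span 0 0" using span.add[OF span_1 span.minus[OF span_1]] by simp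

lemma span_diff: "span x y \<Longrightarrow> span x' y' \<Longrightarrow> span (x - x') (y - y')"
  using span.add[OF _ span.minus, of x y x' y'] by simp

lemma span_mult: "span x y \<Longrightarrow> span x' y' \<Longrightarrow> span (x * x') (y * y')"
proof (induction arbitrary: x' y' rule: span.induct)
  case (gen t s i N)
  show ?case using gen(2)
  proof (induction rule: span.induct)
    case (gen t' s' j M)
    show ?case using span.gen[OF teich_mult[OF \<open>teich t s\<close> gen], of "i + j" "N + M"]
      by (simp add: power_add mult_ac)
  next
    case (add x y x' y')
    show ?case using span.add[OF add.IH] by (simp only: distrib_left)
  next
    case (minus x y)
    show ?case using span.minus[OF minus.IH] by (simp only: mult_minus_right)
  qed
next
  case (add x y x' y')
  show ?case using span.add[OF add.IH(1,2)[OF add.prems]] by (simp only: distrib_right)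
next
  case (minus x y)
  show ?case using span.minus[OF minus.IH[OF minus.prems]] by (simp only: mult_minus_left)
qed

text \<open>
  Exponents are reduced below \<open>e\<close> by the relations \<open>\<pi> ^ e = p \<theta>\<close> and \<open>\<omega> ^ e = p \<eta>\<close>.
\<close>

lemma span_normal_form:
  "span x y \<Longrightarrow> \<exists>N a b. (\<forall>i. teich_ring (a i) (b i)) \<and>
     of_nat p ^ N * x = (\<Sum>i<K1.e. a i * \<pi> ^ i) \<and> of_nat p ^ N * y = (\<Sum>i<K1.e. b i * \<omega> ^ i)"
proof (induction rule: span.induct)
  case (gen t s i N)
  define q r where "q = i div K1.e" and "r = i mod K1.e"
  have i: "i = K1.e * q + r" and r: "r < K1.e" using K1.e_pos by (simp_all add: q_def r_def)
  define a where "a j = (if j = r then t * \<theta> ^ q * of_nat p ^ q else 0)" for j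
  define b where "b j = (if j = r then s * \<eta> ^ q * of_nat p ^ q else 0)" for j
  have "teich_ring (t * \<theta> ^ q * of_nat p ^ q) (s * \<eta> ^ q * of_nat p ^ q)"
    using gen teich_unit
    by (intro teich_ring.mult teich_ring_power teich_ring_of_nat teich_ring.gen)
  hence "\<forall>j. teich_ring (a j) (b j)" using teich_ring_0 by (simp add: a_def b_def)
  moreover have "of_nat p ^ N * (t * \<pi> ^ i / of_nat p ^ N) = (\<Sum>i<K1.e. a i * \<pi> ^ i)"
  proof -
    have "(\<Sum>i<K1.e. a i * \<pi> ^ i) =
        (\<Sum>i<K1.e. if i = r then t * \<theta> ^ q * of_nat p ^ q * \<pi> ^ r else 0)"
      by (intro sum.cong) (auto simp: a_def)
    also have "\<dots> = t * \<theta> ^ q * of_nat p ^ q * \<pi> ^ r" using r by simp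
    also have "\<dots> = t * ((\<pi> ^ K1.e) ^ q * \<pi> ^ r)" unfolding \<pi>_e by (simp add: power_mult_distrib)
    also have "\<dots> = t * \<pi> ^ i" unfolding i by (simp add: power_add power_mult)
    finally show ?thesis using K1.p_nz by simp
  qed
  moreover have "of_nat p ^ N * (s * \<omega> ^ i / of_nat p ^ N) = (\<Sum>i<K1.e. b i * \<omega> ^ i)"
  proof -
    have "(\<Sum>i<K1.e. b i * \<omega> ^ i) =
        (\<Sum>i<K1.e. if i = r then s * \<eta> ^ q * of_nat p ^ q * \<omega> ^ r else 0)"
      by (intro sum.cong) (auto simp: b_def)
    also have "\<dots> = s * \<eta> ^ q * of_nat p ^ q * \<omega> ^ r" using r by simp
    also have "\<dots> = s * ((\<omega> ^ K1.e) ^ q * \<omega> ^ r)" unfolding \<omega>_e by (simp add: power_mult_distrib)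
    also have "\<dots> = s * \<omega> ^ i" unfolding i by (simp add: power_add power_mult)
    finally show ?thesis using K2.p_nz by simp
  qed
  ultimately show ?case by blast
next
  case (add x y x' y')
  obtain N a b where 1: "\<forall>i. teich_ring (a i) (b i)" "of_nat p ^ N * x = (\<Sum>i<K1.e. a i * \<pi> ^ i)"
    "of_nat p ^ N * y = (\<Sum>i<K1.e. b i * \<omega> ^ i)" using add.IH(1) by blast
  obtain M a' b' where 2: "\<forall>i. teich_ring (a' i) (b' i)"
    "of_nat p ^ M * x' = (\<Sum>i<K1.e. a' i * \<pi> ^ i)"
    "of_nat p ^ M * y' = (\<Sum>i<K1.e. b' i * \<omega> ^ i)" using add.IH(2) by blast
  show ?case
  proof (intro exI conjI allI)
    show "teich_ring (of_nat p ^ M * a i + of_nat p ^ N * a' i)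
        (of_nat p ^ M * b i + of_nat p ^ N * b' i)" for i using 1 2
      by (intro teich_ring.add teich_ring.mult teich_ring_power teich_ring_of_nat) auto
    have "of_nat p ^ (N + M) * (x + x') =
      of_nat p ^ M * (of_nat p ^ N * x) + of_nat p ^ N * (of_nat p ^ M * x')"
      by (simp add: power_add algebra_simps)
    also have "\<dots> = (\<Sum>i<K1.e. (of_nat p ^ M * a i + of_nat p ^ N * a' i) * \<pi> ^ i)"
      unfolding 1(2) 2(2) by (simp add: sum_distrib_left distrib_right sum.distrib mult.assoc)
    finally show "of_nat p ^ (N + M) * (x + x') =
      (\<Sum>i<K1.e. (of_nat p ^ M * a i + of_nat p ^ N * a' i) * \<pi> ^ i)" .
    have "of_nat p ^ (N + M) * (y + y') =
      of_nat p ^ M * (of_nat p ^ N * y) + of_nat p ^ N * (of_nat p ^ M * y')"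
      by (simp add: power_add algebra_simps)
    also have "\<dots> = (\<Sum>i<K1.e. (of_nat p ^ M * b i + of_nat p ^ N * b' i) * \<omega> ^ i)"
      unfolding 1(3) 2(3) by (simp add: sum_distrib_left distrib_right sum.distrib mult.assoc)
    finally show "of_nat p ^ (N + M) * (y + y') =
      (\<Sum>i<K1.e. (of_nat p ^ M * b i + of_nat p ^ N * b' i) * \<omega> ^ i)" .
  qed
next
  case (minus x y)
  obtain N a b where 1: "\<forall>i. teich_ring (a i) (b i)" "of_nat p ^ N * x = (\<Sum>i<K1.e. a i * \<pi> ^ i)"
    "of_nat p ^ N * y = (\<Sum>i<K1.e. b i * \<omega> ^ i)" using minus.IH by blast
  show ?case
  proof (intro exI conjI allI)
    show "teich_ring (- a i) (- b i)" for i using 1 by (intro teich_ring.minus) auto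
    show "of_nat p ^ N * - x = (\<Sum>i<K1.e. - a i * \<pi> ^ i)" using 1(2) by (simp add: sum_negf)
    show "of_nat p ^ N * - y = (\<Sum>i<K1.e. - b i * \<omega> ^ i)" using 1(3) by (simp add: sum_negf)
  qed
qed

lemma v_teich_ring_monomial:
  assumes "teich_ring x y" "x \<noteq> 0"
  shows "\<exists>n::nat. v1 (x * \<pi> ^ i) = ereal (real (K1.e * n + i) * K1.u)"
proof -
  obtain n :: nat where "v1 x = ereal (real n)" using teich_ring_integral_value[OF assms] by blast
  hence "v1 (x * \<pi> ^ i) = ereal (real n + real i * K1.u)"
    using K1.v_mult[OF _ K1.v_power[OF v_\<pi>]] by blast
  also have "real n + real i * K1.u = real (K1.e * n + i) * K1.u"
    using K1.e_u by (simp add: algebra_simps)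
  finally show ?thesis by blast
qed

text \<open>
  In the normal form the coefficients have integral values, so the nonzero summands have values in
  distinct residue classes modulo 1 and a bound for the sum bounds each of them. The bounds for the
  coefficients pass to \<open>K2\<close> by the case of the Teichmueller ring.
\<close>

lemma span_transfer:
  assumes "span x y" "K1.ge r x" shows "K2.ge r y"
proof -
  obtain N a b where 1: "\<And>i. teich_ring (a i) (b i)" "of_nat p ^ N * x = (\<Sum>i<K1.e. a i * \<pi> ^ i)"
    "of_nat p ^ N * y = (\<Sum>i<K1.e. b i * \<omega> ^ i)" using span_normal_form[OF assms(1)] by blast
  have vpN: "v1 (of_nat p ^ N) = ereal (real N)" "v2 (of_nat p ^ N) = ereal (real N)"
    using K1.v_power[OF K1.v_p] K2.v_power[OF K2.v_p] by simp_all
  have "K1.ge (real N + r) (\<Sum>i<K1.e. a i * \<pi> ^ i)"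
    unfolding 1(2)[symmetric] using K1.ge_scale[OF vpN(1)] assms(2) by blast
  have "K1.ge (real N + r) (a k * \<pi> ^ k)" if "k < K1.e" for k
  proof (rule K1.ge_summand[of "{..<K1.e}"])
    show "K1.ge (real N + r) (\<Sum>i<K1.e. a i * \<pi> ^ i)" by fact
  next
    fix i j assume ij: "i \<in> {..<K1.e}" "j \<in> {..<K1.e}" "a i * \<pi> ^ i \<noteq> 0"
      "v1 (a i * \<pi> ^ i) = v1 (a j * \<pi> ^ j)"
    have "a j * \<pi> ^ j \<noteq> 0" using ij(3,4) K1.eq_infinity_iff by metis
    hence "a i \<noteq> 0" "a j \<noteq> 0" using ij(3) by auto
    then obtain n n' :: nat where n: "v1 (a i * \<pi> ^ i) = ereal (real (K1.e * n + i) * K1.u)"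
      "v1 (a j * \<pi> ^ j) = ereal (real (K1.e * n' + j) * K1.u)"
      using v_teich_ring_monomial[OF 1(1)] by meson
    have "real (K1.e * n + i) * K1.u = real (K1.e * n' + j) * K1.u" using ij(4) unfolding n by simp
    hence "real (K1.e * n + i) = real (K1.e * n' + j)" using K1.u_pos by simp
    hence "K1.e * n + i = K1.e * n' + j" by (simp only: of_nat_eq_iff)
    hence "(K1.e * n + i) mod K1.e = (K1.e * n' + j) mod K1.e" by simp
    thus "i = j" using ij(1,2) by simp
  qed (use that in auto)
  hence "K2.ge (real N + r) (b i * \<omega> ^ i)" if "i < K1.e" for i
  proof -
    have "K1.ge (real i * K1.u + (real N + r - real i * K1.u)) (\<pi> ^ i * a i)"
      using \<open>\<And>k. k < K1.e \<Longrightarrow> K1.ge (real N + r) (a k * \<pi> ^ k)\<close>[OF that] by (simp add: mult.commute)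
    hence "K1.ge (real N + r - real i * K1.u) (a i)" using K1.ge_scale[OF K1.v_power[OF v_\<pi>]] by blast
    hence "K2.ge (real N + r - real i * K1.u) (b i)" by (rule teich_ring_transfer[OF 1(1)])
    hence "K2.ge (real i * K1.u + (real N + r - real i * K1.u)) (\<omega> ^ i * b i)"
      using K2.ge_scale[OF K2.v_power[OF v_\<omega>]] by blast
    thus ?thesis by (simp add: mult.commute)
  qed
  hence "K2.ge (real N + r) (of_nat p ^ N * y)" unfolding 1(3) by (intro K2.ge_sum) simp
  thus ?thesis using K2.ge_scale[OF vpN(2)] by blast
qed

text \<open>
  Dividing by a suitable monomial in \<open>\<pi>\<close> and \<open>p\<close> leaves a unit, which is congruent to a Teichmueller
  element.
\<close>

lemma leading_monomial:
  assumes d: "v1 d = ereal r"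
  shows "\<exists>t s i N. teich t s \<and> v1 (t * \<pi> ^ i / of_nat p ^ N) = ereal r \<and>
     K1.ge (r + K1.u) (d - t * \<pi> ^ i / of_nat p ^ N)"
proof -
  obtain k :: int where k: "v1 d = ereal (K1.u * real_of_int k)" using K1.v_u K1.v_nz[OF d] by blast
  \<comment> \<open>A power of \<open>p\<close> large enough to make the exponent of \<open>\<pi>\<close> nonnegative.\<close>
  define N where "N = nat \<bar>k\<bar>"
  define i where "i = nat (k + int N * int K1.e)"
  have "int N * 1 \<le> int N * int K1.e" using K1.e_pos by (intro mult_left_mono) auto
  hence "k + int N * int K1.e \<ge> 0" by (simp add: N_def)
  hence "real_of_int (int i) = real_of_int (k + int N * int K1.e)" by (simp add: i_def)
  hence i: "real i = real_of_int k + real N * real K1.e" by simp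
  have ri: "r = real i * K1.u - real N"
  proof -
    have "real i * K1.u = K1.u * real_of_int k + real N * (real K1.e * K1.u)"
      unfolding i by (simp add: algebra_simps)
    thus ?thesis using k d K1.e_u by simp
  qed
  define w where "w = \<pi> ^ i / of_nat p ^ N"
  have w: "v1 w = ereal r" using v_monomial(1)[OF teich_1, of i N] by (simp add: w_def ri)
  have w0: "w \<noteq> 0" using K1.v_nz[OF w] .
  have "v1 (d / w) = 0" using K1.v_divide[OF d w] by (simp add: zero_ereal_def)
  then obtain t s where t: "teich t s" "K1.ge K1.u (d / w - t)" using teich_exists by blast
  have "K1.ge (r + K1.u) (w * (d / w - t))" using K1.ge_scale[OF w] t(2) by blast
  also have "w * (d / w - t) = d - t * \<pi> ^ i / of_nat p ^ N"
    using w0 by (simp add: right_diff_distrib) (simp add: w_def mult.commute)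
  finally show ?thesis using t(1) v_monomial(1)[OF t(1), of i N] ri by blast
qed

text \<open>
  Repeatedly splitting off leading monomials approximates \<open>x\<close>. All monomials have value at least
  \<open>s\<close>, so the additivity errors of \<open>F\<close> stay within the precision \<open>s + \<delta>\<close>.
\<close>

lemma approximation:
  assumes x: "K1.ge s x"
  shows "\<exists>x' y'. span x' y' \<and> K1.ge s x' \<and> K2.ge (s + \<delta>) (y' - F x') \<and>
     K1.ge (s + real k * K1.u) (x - x')"
proof (induction k)
  case 0
  show ?case using x span_0 by (intro exI[of _ 0]) (simp add: F_0)
next
  case (Suc k)
  then obtain x' y' where 1: "span x' y'" "K1.ge s x'" "K2.ge (s + \<delta>) (y' - F x')"
     "K1.ge (s + real k * K1.u) (x - x')" by blast
  show ?case
  proof (cases "x - x' = 0")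
    case True
    thus ?thesis using 1 by (metis K1.ge_0)
  next
    case False
    then obtain r where r: "v1 (x - x') = ereal r" using K1.v_real by blast
    obtain t c i N where 2: "teich t c" "v1 (t * \<pi> ^ i / of_nat p ^ N) = ereal r"
      "K1.ge (r + K1.u) (x - x' - t * \<pi> ^ i / of_nat p ^ N)" using leading_monomial[OF r] by blast
    define a b where "a = t * \<pi> ^ i / of_nat p ^ N" and "b = c * \<omega> ^ i / of_nat p ^ N"
    have rk: "r \<ge> s + real k * K1.u" using 1(4) r by (simp add: K1.ge_iff)
    hence rs: "r \<ge> s" using K1.u_pos by (smt (verit) mult_nonneg_nonneg of_nat_0_le_iff)
    have a: "K1.ge s a" using 2(2) rs by (simp add: a_def K1.ge_iff)
    have "K2.ge (r + \<delta>) (b - F a)" unfolding a_def b_def by (rule monomial_near[OF 2(1,2)])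
    hence "K2.ge (s + \<delta>) (b - F a)" using rs K2.ge_mono by simp
    with 1(3) have "K2.ge (s + \<delta>) ((y' - F x') + (b - F a))" by (rule K2.ge_add)
    moreover have "K2.ge (s + \<delta>) (F (x' + a) - (F x' + F a))"
      unfolding \<delta>_def by (rule F_add[OF 1(2) a])
    ultimately have "K2.ge (s + \<delta>) ((y' - F x') + (b - F a) - (F (x' + a) - (F x' + F a)))"
      by (rule K2.ge_diff)
    hence "K2.ge (s + \<delta>) ((y' + b) - F (x' + a))" by (simp add: algebra_simps)
    moreover have "span (x' + a) (y' + b)"
      unfolding a_def b_def by (intro span.add span.gen 1 2)
    moreover have "K1.ge s (x' + a)" using 1(2) a by (rule K1.ge_add)
    moreover have "K1.ge (s + real (Suc k) * K1.u) (x - (x' + a))"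
    proof -
      have "K1.ge (r + K1.u) (x - (x' + a))" using 2(3) by (simp add: a_def diff_diff_eq)
      thus ?thesis by (rule K1.ge_mono) (use rk in \<open>simp add: algebra_simps\<close>)
    qed
    ultimately show ?thesis by blast
  qed
qed

section \<open>The lift to the complete fields\<close>

definition lift_graph :: "'a \<Rightarrow> 'b \<Rightarrow> bool" where
  "lift_graph x y \<longleftrightarrow> (\<forall>r. \<exists>x' y'. span x' y' \<and> K1.ge r (x - x') \<and> K2.ge r (y - y'))"

lemma lift_graph_span: "span x y \<Longrightarrow> lift_graph x y"
  unfolding lift_graph_def by (intro allI exI[of _ x] exI[of _ y]) simp

lemma lift_graph_transfer:
  assumes "lift_graph x y" "K1.ge r x" shows "K2.ge r y"
proof -
  obtain x' y' where 1: "span x' y'" "K1.ge r (x - x')" "K2.ge r (y - y')"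
    using assms(1) unfolding lift_graph_def by blast
  have "K1.ge r x'" using K1.ge_shift[of r x' x] 1(2) assms(2) K1.ge_commute by blast
  hence "K2.ge r y'" using span_transfer 1 by blast
  thus ?thesis using K2.ge_shift 1 by blast
qed

lemma lift_graph_add:
  assumes "lift_graph x y" "lift_graph a b" shows "lift_graph (x + a) (y + b)"
  unfolding lift_graph_def
proof
  fix r
  obtain x' y' where 1: "span x' y'" "K1.ge r (x - x')" "K2.ge r (y - y')"
    using assms(1) unfolding lift_graph_def by blast
  obtain a' b' where 2: "span a' b'" "K1.ge r (a - a')" "K2.ge r (b - b')"
    using assms(2) unfolding lift_graph_def by blast
  have "K1.ge r ((x - x') + (a - a'))" "K2.ge r ((y - y') + (b - b'))"
    using 1 2 K1.ge_add K2.ge_add by blast+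
  hence "K1.ge r ((x + a) - (x' + a'))" "K2.ge r ((y + b) - (y' + b'))"
    by (simp_all add: algebra_simps)
  thus "\<exists>x' y'. span x' y' \<and> K1.ge r (x + a - x') \<and> K2.ge r (y + b - y')"
    using span.add[OF 1(1) 2(1)] by blast
qed

lemma lift_graph_minus:
  assumes "lift_graph x y" shows "lift_graph (- x) (- y)"
  unfolding lift_graph_def
proof
  fix r
  obtain x' y' where 1: "span x' y'" "K1.ge r (x - x')" "K2.ge r (y - y')"
    using assms(1) unfolding lift_graph_def by blast
  have "K1.ge r (- x - - x')" "K2.ge r (- y - - y')" using 1 K1.ge_commute K2.ge_commute by simp_all
  thus "\<exists>x' y'. span x' y' \<and> K1.ge r (- x - x') \<and> K2.ge r (- y - y')"
    using span.minus[OF 1(1)] by blast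
qed

lemma lift_graph_diff: "lift_graph x y \<Longrightarrow> lift_graph a b \<Longrightarrow> lift_graph (x - a) (y - b)"
  using lift_graph_add[OF _ lift_graph_minus, of x y a b] by simp

lemma value_bounded_below: "\<exists>s. K1.ge s x"
proof (cases "x = 0")
  case False
  then obtain r where "v1 x = ereal r" using K1.v_real by blast
  thus ?thesis by (intro exI[of _ r]) (simp add: K1.ge_iff)
qed simp

lemma lift_graph_mult:
  assumes xy: "lift_graph x y" and ab: "lift_graph a b" shows "lift_graph (x * a) (y * b)"
  unfolding lift_graph_def
proof
  fix r
  obtain s0 s0' where "K1.ge s0 x" "K1.ge s0' a" using value_bounded_below by blast
  define s where "s = min s0 s0'"
  have x: "K1.ge s x" and a: "K1.ge s a"
    using K1.ge_mono \<open>K1.ge s0 x\<close> \<open>K1.ge s0' a\<close> by (simp_all add: s_def)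
  have y: "K2.ge s y" and b: "K2.ge s b" using lift_graph_transfer xy ab x a by blast+
  \<comment> \<open>The part \<open>s\<close> keeps the approximations bounded like \<open>x\<close> and \<open>a\<close>; the part \<open>r - s\<close> gives the precision.\<close>
  define R where "R = max s (r - s)"
  obtain x' y' where 1: "span x' y'" "K1.ge R (x - x')" "K2.ge R (y - y')"
    using assms(1) unfolding lift_graph_def by blast
  obtain a' b' where 2: "span a' b'" "K1.ge R (a - a')" "K2.ge R (b - b')"
    using assms(2) unfolding lift_graph_def by blast
  have "K1.ge s (a' - a)" "K2.ge s (b' - b)"
    using 2 K1.ge_commute K2.ge_commute K1.ge_mono K2.ge_mono unfolding R_def by (meson max.cobounded1)+
  hence ab': "K1.ge s a'" "K2.ge s b'" using K1.ge_shift a K2.ge_shift b by blast+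
  have d: "K1.ge (r - s) (x - x')" "K1.ge (r - s) (a - a')" "K2.ge (r - s) (y - y')" "K2.ge (r - s) (b - b')"
    using 1 2 K1.ge_mono K2.ge_mono unfolding R_def by (meson max.cobounded2)+
  have "K1.ge (s + (r - s)) (x * (a - a') + a' * (x - x'))"
    using x ab' d by (intro K1.ge_add K1.ge_mult)
  moreover have "K2.ge (s + (r - s)) (y * (b - b') + b' * (y - y'))"
    using y ab' d by (intro K2.ge_add K2.ge_mult)
  ultimately have "K1.ge r (x * a - x' * a')" "K2.ge r (y * b - y' * b')"
    by (simp_all add: algebra_simps)
  thus "\<exists>x' y'. span x' y' \<and> K1.ge r (x * a - x') \<and> K2.ge r (y * b - y')"
    using span_mult[OF 1(1) 2(1)] by blast
qed

lemma lift_graph_unique: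
  assumes "lift_graph x y" "lift_graph x y'" shows "y = y'"
proof -
  have "lift_graph 0 (y - y')" using lift_graph_diff[OF assms] by simp
  hence "K2.ge r (y - y')" for r using lift_graph_transfer by simp
  hence "y - y' = 0" by (rule K2.eq_0I)
  thus ?thesis by simp
qed

lemma lift_graph_exists: "\<exists>y. lift_graph x y"
proof -
  obtain s where s: "K1.ge s x" using value_bounded_below by blast
  obtain a b where ab: "\<And>k. span (a k) (b k)" "\<And>k. K1.ge (s + real k * K1.u) (x - a k)"
    using approximation[OF s] by metis
  have "K2.ge (s + real k * K1.u) (b (Suc k) - b k)" for k
  proof (rule span_transfer[OF span_diff[OF ab(1) ab(1)]])
    have "K1.ge (s + real k * K1.u) (a (Suc k) - x)"
      using K1.ge_mono[OF ab(2)[of "Suc k"], of "s + real k * K1.u"] K1.ge_commute K1.u_pos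
      by (simp add: algebra_simps)
    thus "K1.ge (s + real k * K1.u) (a (Suc k) - a k)" using ab(2) K1.ge_diff_trans by blast
  qed
  then obtain y where y: "\<And>k. K2.ge (s + real k * K1.u) (b k - y)"
    using K2.limit_of_steps[OF K1.u_pos, of s b] by blast
  have "lift_graph x y" unfolding lift_graph_def
  proof
    fix r
    obtain k :: nat where "(r - s) / K1.u < real k" using reals_Archimedean2 by blast
    hence r: "r \<le> s + real k * K1.u" using K1.u_pos by (simp add: field_simps)
    have "K1.ge r (x - a k)" using ab(2) r K1.ge_mono by blast
    moreover have "K2.ge r (y - b k)" using y r K2.ge_mono K2.ge_commute by blast
    ultimately show "\<exists>x' y'. span x' y' \<and> K1.ge r (x - x') \<and> K2.ge r (y - y')"
      using ab(1) by blast
  qed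
  thus ?thesis by blast
qed

text \<open>
  The remainder of a good approximation is too small to affect \<open>F x\<close> at the precision considered,
  so the closeness of approximating pairs to \<open>F\<close> is inherited by the limit.
\<close>

lemma lift_graph_near:
  assumes xy: "lift_graph x y" and s: "K1.ge s x" shows "K2.ge (s + \<delta>) (y - F x)"
proof -
  obtain k :: nat where "\<delta> / K1.u < real k" using reals_Archimedean2 by blast
  hence k: "\<delta> \<le> real k * K1.u" using K1.u_pos by (simp add: field_simps)
  obtain x' y' where 1: "span x' y'" "K1.ge s x'" "K2.ge (s + \<delta>) (y' - F x')"
     "K1.ge (s + real k * K1.u) (x - x')" using approximation[OF s] by blast
  have d: "K1.ge (s + \<delta>) (x - x')" using 1(4) k K1.ge_mono by simp
  have 2: "K2.ge (s + \<delta>) (y - y')"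
    using lift_graph_transfer[OF lift_graph_diff[OF xy lift_graph_span[OF 1(1)]] d] .
  have ds: "K1.ge s (x - x')" using d \<delta>_pos K1.ge_mono by simp
  have "K2.ge (s + \<delta>) (F (x' + (x - x')) - (F x' + F (x - x')))"
    unfolding \<delta>_def by (rule F_add[OF 1(2) ds])
  moreover have "K2.ge (s + \<delta>) (F (x - x'))" using d ge_F by blast
  ultimately have
    "K2.ge (s + \<delta>) ((F (x' + (x - x')) - (F x' + F (x - x'))) + F (x - x'))" by (rule K2.ge_add)
  hence "K2.ge (s + \<delta>) (F x - F x')" by simp
  hence "K2.ge (s + \<delta>) (F x' - F x)" using K2.ge_commute by blast
  thus ?thesis using 1(3) 2 K2.ge_diff_trans by blast
qed

definition lift :: "'a \<Rightarrow> 'b" where "lift x = (THE y. lift_graph x y)"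

lemma lift_graph_lift: "lift_graph x (lift x)"
  unfolding lift_def using lift_graph_exists lift_graph_unique by (metis theI)

lemma lift_eq: "lift_graph x y \<Longrightarrow> lift x = y"
  using lift_graph_lift lift_graph_unique by blast

text \<open>
  One inequality for \<open>x\<close> and the same inequality for \<open>1 / x\<close> force equality.
\<close>

lemma v_lift: "v2 (lift x) = v1 x"
proof (cases "x = 0")
  case True
  thus ?thesis using lift_eq[OF lift_graph_span[OF span_0]] by (simp add: K1.v_0 K2.v_0)
next
  case False
  then obtain r where r: "v1 x = ereal r" using K1.v_real by blast
  have "lift_graph (x * (1 / x)) (lift x * lift (1 / x))"
    by (intro lift_graph_mult lift_graph_lift)
  hence 1: "lift x * lift (1 / x) = 1"
    using False lift_graph_unique lift_graph_span[OF span_1] by simp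
  hence "lift x \<noteq> 0" by auto
  then obtain a where a: "v2 (lift x) = ereal a" using K2.v_real by blast
  have "v2 (1 / lift x) = ereal (- a)" by (rule K2.v_inverse[OF a])
  moreover have "lift (1 / x) = 1 / lift x" using 1 \<open>lift x \<noteq> 0\<close> by (simp add: field_simps)
  ultimately have b: "v2 (lift (1 / x)) = ereal (- a)" by simp
  have "K2.ge r (lift x)" using lift_graph_transfer[OF lift_graph_lift] r by (simp add: K1.ge_iff)
  moreover have "K2.ge (- r) (lift (1 / x))"
    using lift_graph_transfer[OF lift_graph_lift] K1.v_inverse[OF r] by (simp add: K1.ge_iff)
  ultimately show ?thesis using a b r by (simp add: K2.ge_iff)
qed

lemma lift_hom: "lift \<in> valued_field_hom v1 v2"
  unfolding valued_field_hom_def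
proof (intro CollectI conjI allI)
  show "lift 1 = 1" by (intro lift_eq lift_graph_span span_1)
  show "lift (x + y) = lift x + lift y" for x y by (intro lift_eq lift_graph_add lift_graph_lift)
  show "lift (x * y) = lift x * lift y" for x y by (intro lift_eq lift_graph_mult lift_graph_lift)
  show "v1 a < v1 b \<longleftrightarrow> v2 (lift a) < v2 (lift b)" for a b by (simp add: v_lift)
qed

lemma lift_class: "hclass v2 m (F x) = hclass v2 m (lift x)"
proof (cases "x = 0")
  case True
  thus ?thesis using lift_eq[OF lift_graph_span[OF span_0]] by (simp add: F_0)
next
  case False
  then obtain r where r: "v1 x = ereal r" using K1.v_real by blast
  have "K2.ge (r + \<delta>) (lift x - F x)"
    using lift_graph_near[OF lift_graph_lift] r by (simp add: K1.ge_iff)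
  thus ?thesis using class_diff[of "F x" r "lift x"] r by (simp add: v_F)
qed

text \<open>
  A homomorphism \<open>g\<close> inducing the same classes sends a Teichmueller element to an element with the
  same residue and with \<open>p\<close>-power roots of all orders, hence to the matching Teichmueller element; it sends
  \<open>\<pi>\<close> to an \<open>e\<close>-th root of \<open>p \<eta>\<close> in the class of \<open>\<omega>\<close>, hence to \<open>\<omega>\<close>. So it is determined on the
  dense span, and it is continuous because it preserves values.
\<close>

lemma lift_unique:
  assumes g: "g \<in> valued_field_hom v1 v2" and near: "\<And>x. hclass v2 m (F x) = hclass v2 m (g x)"
  shows "g = lift"
proof -
  have g1: "g 1 = 1" and gadd: "\<And>x y. g (x + y) = g x + g y" and gmult: "\<And>x y. g (x * y) = g x * g y"
    using g unfolding valued_field_hom_def by auto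
  have g0: "g 0 = 0" using gadd[of 0 0] by simp
  have gminus: "g (- x) = - g x" for x using gadd[of x "- x"] g0 by (simp add: eq_neg_iff_add_eq_0 add.commute)
  have gdiff: "g (x - y) = g x - g y" for x y using gadd[of x "- y"] gminus by simp
  have gpow: "g (x ^ k) = g x ^ k" for x k by (induction k) (simp_all add: g1 gmult)
  have gnat: "g (of_nat k) = of_nat k" for k by (induction k) (simp_all add: g0 g1 gadd)
  have gdiv: "g (x / y) = g x / g y" if "y \<noteq> 0" for x y
  proof -
    have "g (x / y) * g y = g x" using gmult[of "x / y" y] that by simp
    moreover have "g y * g (1 / y) = 1" using gmult[of y "1 / y"] that g1 by simp
    hence "g y \<noteq> 0" by auto
    ultimately show ?thesis by (simp add: field_simps)
  qed
  have vg: "v2 (g x) = v1 x" for x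
    using K2.v_hclass[OF m_pos, of "F x" "g x"] near[of x] K2.hclass_self v_F by metis
  have geg: "K2.ge r (g x)" if "K1.ge r x" for r x using that by (simp add: val_ge_def vg)
  have nearu: "K2.ge K2.u (g x - F x)" if "v1 x = 0" for x
  proof -
    have "v2 (F x) = ereal 0" using that by (simp add: v_F zero_ereal_def)
    hence "K2.ge \<delta> (g x - F x)" using class_diff[of "F x" 0 "g x"] near by simp
    thus ?thesis using K2.ge_mono u_le_\<delta> by blast
  qed
  have teich: "g t = s" if ts: "teich t s" for t s
  proof -
    have "K2.ge (0 + real k * K2.u) (g t - s)" for k
    proof -
      obtain t' s' where *: "teich t' s'" "t' ^ (p ^ k) = t" "s' ^ (p ^ k) = s"
        using teich_root_pk[OF ts] by metis
      have s0: "K2.ge 0 s'" using teich_v[OF *(1)] by (simp add: val_ge_def zero_ereal_def)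
      have "K2.ge K2.u (g t' - s')"
        using nearu[of t'] teich_v[OF *(1)] teich_near_u[OF *(1)] K2.ge_diff_trans K2.ge_commute by blast
      from K2.power_pk_contract[OF s0 this, of k]
      have "K2.ge (real (Suc k) * K2.u) (g t - s)" using * gpow by metis
      thus ?thesis by (rule K2.ge_mono) (use K2.u_pos in simp)
    qed
    hence "g t - s = 0" by (rule K2.eq_0I_step[OF K2.u_pos])
    thus ?thesis by simp
  qed
  have g\<pi>: "g \<pi> = \<omega>"
  proof -
    have \<omega>0: "\<omega> \<noteq> 0" using K2.v_nz[OF v_\<omega>] .
    have "v2 (F \<pi>) = ereal K1.u" by (simp add: v_F v_\<pi>)
    hence "K2.ge (K1.u + \<delta>) (g \<pi> - F \<pi>)" using class_diff[of "F \<pi>" K1.u "g \<pi>"] near by simp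
    hence "K2.ge (K1.u + \<delta>) (g \<pi> - \<omega>)" using \<omega>_near K2.ge_diff_trans K2.ge_commute by blast
    moreover have "g \<pi> - \<omega> = \<omega> * (g \<pi> / \<omega> - 1)" using \<omega>0 by (simp add: right_diff_distrib)
    ultimately have "K2.ge \<delta> (g \<pi> / \<omega> - 1)" using K2.ge_scale[OF v_\<omega>] by metis
    hence "K2.ge K2.u (g \<pi> / \<omega> - 1)" using K2.ge_mono u_le_\<delta> by blast
    moreover have "g \<pi> ^ K1.e = \<omega> ^ K1.e"
      using gpow[of \<pi> K1.e] teich[OF teich_unit] by (simp add: \<pi>_e \<omega>_e gmult gnat)
    hence "(g \<pi> / \<omega>) ^ K1.e = 1" using \<omega>0 by (simp add: power_divide)
    ultimately have "g \<pi> / \<omega> = 1" using K2.root_of_unity_trivial[OF tame] by blast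
    thus ?thesis using \<omega>0 by simp
  qed
  have span: "g x = y" if "span x y" for x y
    using that
  proof (induction rule: span.induct)
    case (gen t s i N)
    have "(of_nat p ^ N :: 'a) \<noteq> 0" using K1.p_nz by simp
    thus ?case using gdiv gmult gpow gnat teich[OF gen] g\<pi> by simp
  qed (simp_all add: gadd gminus)
  have "lift_graph x (g x)" for x unfolding lift_graph_def
  proof
    fix r
    obtain x' y' where 1: "span x' y'" "K1.ge r (x - x')"
      using lift_graph_exists[of x] unfolding lift_graph_def by blast
    have "K2.ge r (g x - y')" using geg[OF 1(2)] gdiff span[OF 1(1)] by simp
    thus "\<exists>x' y'. span x' y' \<and> K1.ge r (x - x') \<and> K2.ge r (g x - y')" using 1 by blast
  qed
  hence "g x = lift x" for x using lift_eq by metis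
  thus ?thesis by (rule ext)
qed

end

lemma (in hyperfield_lift) ex1_lift:
  "\<exists>!g. g \<in> valued_field_hom v1 v2 \<and> (\<forall>x. hclass v2 m (F x) = hclass v2 m (g x))"
proof -
  obtain \<pi> \<omega> \<theta> \<eta> where "teich \<theta> \<eta>" "v1 \<pi> = ereal K1.u" "\<pi> ^ K1.e = of_nat p * \<theta>"
     "\<omega> ^ K1.e = of_nat p * \<eta>" "K2.ge (K1.u + \<delta>) (\<omega> - F \<pi>)" using uniformizer_pair_exists by blast
  then interpret hyperfield_lift_uniformizers v1 v2 p F m \<pi> \<theta> \<omega> \<eta> by unfold_locales
  show ?thesis using lift_hom lift_class lift_unique by metis
qed

section \<open>Homomorphisms of hyperfields and of valued fields\<close>

context mixed_char_discrete_valuation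
begin

lemma hmult_hclass:
  assumes "n \<ge> 1" shows "hmult v n (hclass v n x) (hclass v n y) = hclass v n (x * y)"
  unfolding hmult_def using hclass_mult[OF assms] by (intro the_equality) metis+

lemma hval_hclass:
  assumes "n \<ge> 1" shows "hval v n (hclass v n x) = v x"
  unfolding hval_def using v_hclass[OF assms] hclass_self by (intro the_equality) metis+

lemma hclass_near:
  assumes "b \<in> hclass v n x" "ge s x" shows "ge (s + real n * u) (b - x)"
proof (cases "x = 0")
  case True
  thus ?thesis using assms by (simp add: hclass_0)
next
  case False
  then obtain r where r: "v x = ereal r" using v_real by blast
  show ?thesis using assms ge_mono[of "r + real n * u" "b - x" "s + real n * u"]
    by (simp add: mem_hclass[OF r] ge_iff[OF r])
qed

end

text \<open>
  The value of \<open>x ^ e\<close> is an integer, hence that of a power of \<open>p\<close>, and equality of values is preserved.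
  The auxiliary factor \<open>p ^ N\<close> serves to make the exponent of \<open>p\<close> a natural number.
\<close>

lemma value_preserved:
  fixes v1 :: "'a::field_char_0 \<Rightarrow> ereal" and v2 :: "'b::field_char_0 \<Rightarrow> ereal"
  assumes v1: "mixed_char_discrete_valuation v1 p" and v2: "mixed_char_discrete_valuation v2 p"
    and F_0: "F 0 = 0" and F_p: "v2 (F (of_nat p)) = 1"
    and F_mult: "\<And>x y. v2 (F (x * y)) = v2 (F x) + v2 (F y)"
    and F_le: "\<And>x y. v1 x \<le> v1 y \<longleftrightarrow> v2 (F x) \<le> v2 (F y)"
  shows "v2 (F x) = v1 x"
proof -
  interpret K1: mixed_char_discrete_valuation v1 p by fact
  interpret K2: mixed_char_discrete_valuation v2 p by fact
  show ?thesis
  proof (cases "x = 0")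
    case True
    thus ?thesis using F_0 by (simp add: K1.v_0 K2.v_0)
  next
    case False
    have finite: "\<exists>r. v2 (F y) = ereal r" if "y \<noteq> 0" for y
    proof -
      obtain r where "v1 y = ereal r" using K1.v_real \<open>y \<noteq> 0\<close> by blast
      hence "\<not> v1 0 \<le> v1 y" by (simp add: K1.v_0)
      hence "F y \<noteq> 0" using F_le[of 0 y] F_0 by auto
      thus ?thesis by (rule K2.v_real)
    qed
    have power: "v2 (F (y ^ k)) = ereal (real k * r)" if r: "v2 (F y) = ereal r" for y r k
    proof (induction k)
      case 0
      obtain b where b: "v2 (F 1) = ereal b" using finite[of 1] by auto
      have "v2 (F 1) = v2 (F 1) + v2 (F 1)" using F_mult[of 1 1] by simp
      thus ?case using b by simp
    next
      case (Suc k)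
      show ?case using F_mult[of y "y ^ k"] Suc r by (simp add: algebra_simps)
    qed
    obtain i :: int where i: "v1 x = ereal (K1.u * real_of_int i)" using K1.v_u False by blast
    obtain a where a: "v2 (F x) = ereal a" using finite False by blast
    define N j where "N = nat \<bar>i\<bar>" and "j = nat (i + int N)"
    have "int j = i + int N" by (simp add: N_def j_def)
    hence j: "real j = real_of_int i + real N" by (metis of_int_add of_int_of_nat_eq)
    have Fp: "v2 (F (of_nat p)) = ereal 1" using F_p by (simp add: one_ereal_def)
    have "real K1.e * (K1.u * real_of_int i) = (real K1.e * K1.u) * real_of_int i" by simp
    also have "\<dots> = real_of_int i" unfolding K1.e_u by simp
    finally have "v1 (x ^ K1.e * of_nat p ^ N) = ereal (real_of_int i + real N)"
      using K1.v_mult[OF K1.v_power[OF i] K1.v_power[OF K1.v_p], of K1.e N] by simp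
    also have "\<dots> = v1 (of_nat p ^ j)" using K1.v_power[OF K1.v_p, of j] j by simp
    finally have "v2 (F (x ^ K1.e * of_nat p ^ N)) = v2 (F (of_nat p ^ j))"
      using F_le by (metis order_antisym order_refl)
    hence "real K1.e * a + real N = real j"
      using power[OF a, of K1.e] power[OF Fp, of N] power[OF Fp, of j] F_mult by simp
    hence "real K1.e * a = real_of_int i" using j by simp
    hence "a = K1.u * real_of_int i" using K1.e_pos by (simp add: K1.u_def field_simps)
    thus ?thesis using a i by simp
  qed
qed

lemma valued_field_hom_of_nat: "g \<in> valued_field_hom v1 v2 \<Longrightarrow> g (of_nat k) = of_nat k"
proof (induction k)
  case 0
  have "g (0 + 0) = g 0 + g 0" using 0 unfolding valued_field_hom_def by blast
  thus ?case by simp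
qed (simp add: valued_field_hom_def)

lemma valued_field_hom_value:
  assumes "mixed_char_discrete_valuation v1 p" "mixed_char_discrete_valuation v2 p"
    and g: "g \<in> valued_field_hom v1 v2"
  shows "v2 (g x) = v1 x"
proof (rule value_preserved[OF assms(1,2)])
  interpret K2: mixed_char_discrete_valuation v2 p by fact
  show "g 0 = 0" using valued_field_hom_of_nat[OF g, of 0] by simp
  show "v2 (g (of_nat p)) = 1" using valued_field_hom_of_nat[OF g] K2.normalized by simp
  show "v2 (g (x * y)) = v2 (g x) + v2 (g y)" for x y
    using g K2.mult by (simp add: valued_field_hom_def)
  show "v1 x \<le> v1 y \<longleftrightarrow> v2 (g x) \<le> v2 (g y)" for x y
    using g unfolding valued_field_hom_def by (metis (mono_tags, lifting) mem_Collect_eq not_less)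
qed

lemma valued_field_hom_diff:
  assumes g: "g \<in> valued_field_hom v1 v2" shows "g (x - y) = g x - g y"
proof -
  have "g ((x - y) + y) = g (x - y) + g y" using g unfolding valued_field_hom_def by blast
  thus ?thesis by simp
qed

locale hyperfield_pair =
  K1: complete_mixed_valuation v1 p + K2: complete_mixed_valuation v2 p
  for v1 :: "'a::field_char_0 \<Rightarrow> ereal" and v2 :: "'b::field_char_0 \<Rightarrow> ereal" and p +
  fixes n m :: nat
  assumes n: "n \<ge> 1" and m: "m \<ge> 1"
    and perfect1: "perfect_field (residue_field v1)"
    and tame1: "tamely_ramified v1 p"
begin

abbreviation "H \<equiv> hyperfield_hom_over p v1 n v2 m"
abbreviation "V \<equiv> valued_field_hom v1 v2"
abbreviation "cl1 \<equiv> hclass v1 n"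
abbreviation "cl2 \<equiv> hclass v2 m"

lemma hclass_in: "cl1 x \<in> hyperfield v1 n" "cl2 y \<in> hyperfield v2 m"
  by (simp_all add: hyperfield_def)

lemma hyperfield_homD:
  assumes "f \<in> H"
  shows "\<exists>y. f (cl1 x) = cl2 y" "f (cl1 0) = cl2 0" "f (cl1 1) = cl2 1"
    "f (cl1 (of_nat p)) = cl2 (of_nat p)"
    "f (cl1 (x * y)) = hmult v2 m (f (cl1 x)) (f (cl1 y))"
    "f (cl1 (x + y)) \<in> hadd v2 m (f (cl1 x)) (f (cl1 y))"
    "v1 x \<le> v1 y \<longleftrightarrow> hval v2 m (f (cl1 x)) \<le> hval v2 m (f (cl1 y))"
proof -
  have f: "f \<in> hyperfield_hom v1 n v2 m" "f (cl1 (of_nat p)) = cl2 (of_nat p)"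
    using assms by (auto simp: hyperfield_hom_over_def)
  have ext: "f \<in> hyperfield v1 n \<rightarrow>\<^sub>E hyperfield v2 m" using f by (simp add: hyperfield_hom_def)
  have "f (cl1 x) \<in> hyperfield v2 m" using PiE_mem[OF ext hclass_in(1)] .
  thus "\<exists>y. f (cl1 x) = cl2 y" unfolding hyperfield_def by blast
  show "f (cl1 0) = cl2 0" "f (cl1 1) = cl2 1" using f by (simp_all add: hyperfield_hom_def)
  show "f (cl1 (of_nat p)) = cl2 (of_nat p)" by fact
  have *: "f (hmult v1 n (cl1 x) (cl1 y)) = hmult v2 m (f (cl1 x)) (f (cl1 y)) \<and>
     f ` hadd v1 n (cl1 x) (cl1 y) \<subseteq> hadd v2 m (f (cl1 x)) (f (cl1 y)) \<and>
     (hval v1 n (cl1 x) \<le> hval v1 n (cl1 y) \<longleftrightarrow> hval v2 m (f (cl1 x)) \<le> hval v2 m (f (cl1 y)))"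
    using f(1) hclass_in(1) unfolding hyperfield_hom_def by blast
  show "f (cl1 (x * y)) = hmult v2 m (f (cl1 x)) (f (cl1 y))"
    using * by (simp add: K1.hmult_hclass[OF n])
  have "cl1 (x + y) \<in> hadd v1 n (cl1 x) (cl1 y)"
    unfolding hadd_def using K1.hclass_self by blast
  thus "f (cl1 (x + y)) \<in> hadd v2 m (f (cl1 x)) (f (cl1 y))" using * by blast
  show "v1 x \<le> v1 y \<longleftrightarrow> hval v2 m (f (cl1 x)) \<le> hval v2 m (f (cl1 y))"
    using * by (simp add: K1.hval_hclass[OF n])
qed

text \<open>
  Choosing representatives of the images of all classes gives the map \<open>F\<close> of the preceding
  construction; the inclusion of hypersums bounds its additivity error.
\<close>

lemma ex1_inducing:
  assumes f: "f \<in> H" shows "\<exists>!g. g \<in> V \<and> induced_from v1 n v2 m f g"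
proof -
  define F where "F x = (SOME y. f (cl1 x) = cl2 y)" for x
  have F: "f (cl1 x) = cl2 (F x)" for x
    unfolding F_def using someI_ex[OF hyperfield_homD(1)[OF f]] .
  have "cl2 (F 0) = cl2 0" using hyperfield_homD(2)[OF f] F by simp
  hence F_0: "F 0 = 0" using K2.hclass_0 K2.hclass_self by blast
  have F_mult: "cl2 (F (x * y)) = cl2 (F x * F y)" for x y
    using hyperfield_homD(5)[OF f, of x y] by (simp add: F K2.hmult_hclass[OF m])
  have F_p: "cl2 (F (of_nat p)) = cl2 (of_nat p)" using hyperfield_homD(4)[OF f] by (simp add: F)
  have v_cl2: "v2 x = v2 y" if "cl2 x = cl2 y" for x y
    using that K2.v_hclass[OF m] K2.hclass_self by blast
  have v_F: "v2 (F x) = v1 x" for x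
  proof (rule value_preserved[of v1 p v2])
    show "v2 (F (of_nat p)) = 1" using v_cl2[OF F_p] K2.normalized by simp
    show "v2 (F (x * y)) = v2 (F x) + v2 (F y)" for x y using v_cl2[OF F_mult] K2.mult by simp
    show "v1 x \<le> v1 y \<longleftrightarrow> v2 (F x) \<le> v2 (F y)" for x y
      using hyperfield_homD(7)[OF f, of x y] by (simp add: F K2.hval_hclass[OF m])
  qed (rule K1.mixed_char_discrete_valuation_axioms K2.mixed_char_discrete_valuation_axioms F_0)+
  interpret hyperfield_lift v1 v2 p F m
  proof unfold_locales
    show "m \<ge> 1" by (rule m)
    show "K1.ge 0 x \<Longrightarrow> \<exists>y. K1.ge 0 y \<and> K1.ge K1.u (x - y ^ p)" for x
      by (rule K1.perfect_residue[OF perfect1])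
    show "\<not> p dvd ramification_index v1 p" using tame1 by (simp add: tamely_ramified_def)
    show "F 0 = 0" "\<And>x. v2 (F x) = v1 x" "cl2 (F (of_nat p)) = cl2 (of_nat p)"
      "\<And>x y. cl2 (F (x * y)) = cl2 (F x * F y)" by (rule F_0 v_F F_p F_mult)+
    show "cl2 (F 1) = cl2 1" using hyperfield_homD(3)[OF f] by (simp add: F)
    fix s x y assume xy: "K1.ge s x" "K1.ge s y"
    have "cl2 (F (x + y)) \<in> hadd v2 m (cl2 (F x)) (cl2 (F y))"
      using hyperfield_homD(6)[OF f, of x y] by (simp add: F)
    then obtain a b where ab: "a \<in> cl2 (F x)" "b \<in> cl2 (F y)" "cl2 (F (x + y)) = cl2 (a + b)"
      unfolding hadd_def by blast
    have Fs: "K2.ge s (F x)" "K2.ge s (F y)" using xy by (simp_all add: val_ge_def v_F)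
    have "K2.ge s a" "K2.ge s b" using Fs K2.v_hclass[OF m] ab by (simp_all add: val_ge_def)
    hence "K2.ge s (a + b)" by (rule K2.ge_add)
    moreover have "F (x + y) \<in> cl2 (a + b)" using ab(3) K2.hclass_self by blast
    ultimately have "K2.ge (s + real m * K2.u) (F (x + y) - (a + b))" using K2.hclass_near by blast
    moreover have "K2.ge (s + real m * K2.u) ((a - F x) + (b - F y))"
      using K2.hclass_near ab Fs by (intro K2.ge_add) auto
    ultimately have "K2.ge (s + real m * K2.u) ((F (x + y) - (a + b)) + ((a - F x) + (b - F y)))"
      by (rule K2.ge_add)
    thus "K2.ge (s + real m * K2.u) (F (x + y) - (F x + F y))" by (simp add: algebra_simps)
  qed
  show ?thesis using ex1_lift unfolding induced_from_def F .
qed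

definition \<Phi> where "\<Phi> f = (THE g. g \<in> V \<and> induced_from v1 n v2 m f g)"

lemma \<Phi>: "f \<in> H \<Longrightarrow> \<Phi> f \<in> V" "f \<in> H \<Longrightarrow> f (cl1 x) = cl2 (\<Phi> f x)"
  using theI'[OF ex1_inducing] unfolding \<Phi>_def induced_from_def by blast+

lemma \<Phi>_eqI: "f \<in> H \<Longrightarrow> g \<in> V \<Longrightarrow> induced_from v1 n v2 m f g \<Longrightarrow> \<Phi> f = g"
  unfolding \<Phi>_def by (rule the1_equality[OF ex1_inducing]) blast+

text \<open>
  The converse construction: a field homomorphism that is well defined on classes is a homomorphism of
  hyperfields, because sums of representatives are sent to sums of representatives.
\<close>

lemma descends_induces:
  assumes g: "g \<in> V" and d: "descends v1 n v2 m g"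
  shows "\<exists>f\<in>H. induced_from v1 n v2 m f g"
proof -
  define f where "f = (\<lambda>\<alpha>\<in>hyperfield v1 n. cl2 (g (SOME x. cl1 x = \<alpha>)))"
  have f: "f (cl1 x) = cl2 (g x)" for x
  proof -
    have "cl1 (SOME y. cl1 y = cl1 x) = cl1 x" by (rule someI) simp
    hence "cl2 (g (SOME y. cl1 y = cl1 x)) = cl2 (g x)" using d unfolding descends_def by blast
    thus ?thesis unfolding f_def restrict_def using hclass_in(1) by simp
  qed
  have vg: "v2 (g x) = v1 x" for x
    by (rule valued_field_hom_value[OF K1.mixed_char_discrete_valuation_axioms
          K2.mixed_char_discrete_valuation_axioms g])
  have g': "g 1 = 1" "\<And>x y. g (x + y) = g x + g y" "\<And>x y. g (x * y) = g x * g y"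
    using g unfolding valued_field_hom_def by auto
  have g0: "g 0 = 0" using valued_field_hom_of_nat[OF g, of 0] by simp
  have "f \<in> H" unfolding hyperfield_hom_over_def hyperfield_hom_def
  proof (intro CollectI conjI ballI)
    show "f \<in> hyperfield v1 n \<rightarrow>\<^sub>E hyperfield v2 m" unfolding f_def using hclass_in(2) by auto
    show "f (cl1 0) = cl2 0" "f (cl1 1) = cl2 1" by (simp_all add: f g' g0)
    show "f (cl1 (of_nat p)) = cl2 (of_nat p)" by (simp add: f valued_field_hom_of_nat[OF g])
    fix \<alpha> \<beta> assume "\<alpha> \<in> hyperfield v1 n" "\<beta> \<in> hyperfield v1 n"
    then obtain x y where \<alpha>: "\<alpha> = cl1 x" and \<beta>: "\<beta> = cl1 y" unfolding hyperfield_def by blast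
    show "f (hmult v1 n \<alpha> \<beta>) = hmult v2 m (f \<alpha>) (f \<beta>)"
      by (simp add: \<alpha> \<beta> f K1.hmult_hclass[OF n] K2.hmult_hclass[OF m] g')
    show "hval v1 n \<alpha> \<le> hval v1 n \<beta> \<longleftrightarrow> hval v2 m (f \<alpha>) \<le> hval v2 m (f \<beta>)"
      by (simp add: \<alpha> \<beta> f K1.hval_hclass[OF n] K2.hval_hclass[OF m] vg)
    show "f ` hadd v1 n \<alpha> \<beta> \<subseteq> hadd v2 m (f \<alpha>) (f \<beta>)"
    proof
      fix \<gamma> assume "\<gamma> \<in> f ` hadd v1 n \<alpha> \<beta>"
      then obtain x' y' where *: "x' \<in> cl1 x" "y' \<in> cl1 y" "\<gamma> = f (cl1 (x' + y'))"
        unfolding hadd_def \<alpha> \<beta> by blast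
      have "cl2 (g x') = cl2 (g x)" "cl2 (g y') = cl2 (g y)"
        using * K1.hclass_eqI[OF n] d unfolding descends_def by blast+
      hence "g x' \<in> f \<alpha>" "g y' \<in> f \<beta>" using K2.hclass_self unfolding \<alpha> \<beta> f by blast+
      moreover have "\<gamma> = cl2 (g x' + g y')" using * by (simp add: f g')
      ultimately show "\<gamma> \<in> hadd v2 m (f \<alpha>) (f \<beta>)" unfolding hadd_def by blast
    qed
  qed
  thus ?thesis using f unfolding induced_from_def by blast
qed

lemma \<Phi>_bij: "bij_betw \<Phi> H {g \<in> V. descends v1 n v2 m g}"
proof (rule bij_betw_imageI)
  show "inj_on \<Phi> H"
  proof (rule inj_onI)
    fix f f' assume ff': "f \<in> H" "f' \<in> H" "\<Phi> f = \<Phi> f'"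
    have "f \<in> extensional (hyperfield v1 n)" "f' \<in> extensional (hyperfield v1 n)"
      using ff' by (auto simp: hyperfield_hom_over_def hyperfield_hom_def PiE_def)
    thus "f = f'"
    proof (rule extensionalityI)
      fix \<alpha> assume "\<alpha> \<in> hyperfield v1 n"
      thus "f \<alpha> = f' \<alpha>" using \<Phi>(2)[OF ff'(1)] \<Phi>(2)[OF ff'(2)] ff'(3) unfolding hyperfield_def by auto
    qed
  qed
  show "\<Phi> ` H = {g \<in> V. descends v1 n v2 m g}"
  proof (intro subset_antisym subsetI)
    fix g assume "g \<in> \<Phi> ` H"
    then obtain f where f: "f \<in> H" "g = \<Phi> f" by blast
    have "descends v1 n v2 m g" unfolding descends_def f(2) using \<Phi>(2)[OF f(1)] by metis
    thus "g \<in> {g \<in> V. descends v1 n v2 m g}" using \<Phi>(1)[OF f(1)] f(2) by simp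
  next
    fix g assume g: "g \<in> {g \<in> V. descends v1 n v2 m g}"
    then obtain f where "f \<in> H" "induced_from v1 n v2 m f g" using descends_induces by blast
    thus "g \<in> \<Phi> ` H" using \<Phi>_eqI g by blast
  qed
qed

text \<open>
  Since \<open>g\<close> preserves values, it maps \<open>1 + M ^ n\<close> into \<open>1 + M ^ m\<close> exactly if \<open>m / e2 \<le> n / e1\<close>. An element
  \<open>1 + a\<close> with \<open>a\<close> of value exactly \<open>n / e1\<close> shows that the condition is necessary.
\<close>

lemma descends_iff:
  assumes g: "g \<in> V"
  shows "descends v1 n v2 m g \<longleftrightarrow> m * ramification_index v1 p \<le> n * ramification_index v2 p"
proof -
  have vg: "v2 (g x) = v1 x" for x
    by (rule valued_field_hom_value[OF K1.mixed_char_discrete_valuation_axioms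
          K2.mixed_char_discrete_valuation_axioms g])
  have "real m * K2.u \<le> real n * K1.u \<longleftrightarrow> real m * real K1.e \<le> real n * real K2.e"
    using K1.e_pos K2.e_pos by (simp add: K1.u_def K2.u_def field_simps)
  also have "\<dots> \<longleftrightarrow> m * K1.e \<le> n * K2.e" by (simp only: of_nat_mult[symmetric] of_nat_le_iff)
  finally have ineq: "m * K1.e \<le> n * K2.e \<longleftrightarrow> real m * K2.u \<le> real n * K1.u" by blast
  show ?thesis unfolding ineq
  proof
    assume d: "descends v1 n v2 m g"
    obtain a where a: "v1 a = ereal (real n * K1.u)" using K1.ex_v[of "int n"] by (auto simp: mult.commute)
    have "cl1 (1 + a) = cl1 1"
      using K1.hclass_eq_diff[OF n, of 1 0] a by (simp add: K1.v_1 zero_ereal_def K1.ge_iff)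
    hence "cl2 (g (1 + a)) = cl2 (g 1)" using d unfolding descends_def by blast
    hence "cl2 (1 + g a) = cl2 1" using g by (simp add: valued_field_hom_def)
    hence "K2.ge (real m * K2.u) (g a)"
      using K2.hclass_eq_diff[OF m, of 1 0] by (simp add: K2.v_1 zero_ereal_def)
    thus "real m * K2.u \<le> real n * K1.u" using a vg by (simp add: K2.ge_iff)
  next
    assume le: "real m * K2.u \<le> real n * K1.u"
    show "descends v1 n v2 m g" unfolding descends_def
    proof (intro allI impI)
      fix x y assume eq: "cl1 x = cl1 y"
      show "cl2 (g x) = cl2 (g y)"
      proof (cases "y = 0")
        case True
        hence "x = 0" using eq K1.hclass_0 K1.hclass_self by blast
        thus ?thesis using True by simp
      next
        case False
        then obtain r where r: "v1 y = ereal r" using K1.v_real by blast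
        have "K1.ge (r + real n * K1.u) (x - y)" using K1.hclass_eq_diff[OF n r] eq by blast
        hence "K1.ge (r + real m * K2.u) (x - y)" using le K1.ge_mono by simp
        hence "K2.ge (r + real m * K2.u) (g x - g y)"
          using vg[of "x - y"] valued_field_hom_diff[OF g] by (simp add: val_ge_def)
        thus ?thesis using K2.hclass_eq_diff[OF m, of "g y" r] r vg by simp
      qed
    qed
  qed
qed

end

section \<open>The correspondence\<close>

theorem theorem3p7:
  fixes v1 :: "'a::field_char_0 \<Rightarrow> ereal" and v2 :: "'b::field_char_0 \<Rightarrow> ereal"
    and p n m :: nat
  assumes "mixed_char_discrete_valuation v1 p" and "mixed_char_discrete_valuation v2 p"
    and "valuation_complete v1" and "valuation_complete v2"
    and "perfect_field (residue_field v1)" and "perfect_field (residue_field v2)"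
    and "n \<ge> 1" and "m \<ge> 1"
    and "tamely_ramified v1 p"
  shows "(\<forall>f\<in>hyperfield_hom_over p v1 n v2 m.
            \<exists>!g. g \<in> valued_field_hom v1 v2 \<and> induced_from v1 n v2 m f g) \<and>
         (let \<Phi> = (\<lambda>f. THE g. g \<in> valued_field_hom v1 v2 \<and> induced_from v1 n v2 m f g) in
            bij_betw \<Phi> (hyperfield_hom_over p v1 n v2 m)
              {g \<in> valued_field_hom v1 v2. descends v1 n v2 m g} \<and>
            (bij_betw \<Phi> (hyperfield_hom_over p v1 n v2 m) (valued_field_hom v1 v2) \<longleftrightarrow>
               m * ramification_index v1 p \<le> n * ramification_index v2 p \<or>
               valued_field_hom v1 v2 = {}))"
proof -
  interpret K1: mixed_char_discrete_valuation v1 p by fact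
  interpret K2: mixed_char_discrete_valuation v2 p by fact
  interpret hyperfield_pair v1 v2 p n m by unfold_locales (use assms in auto)
  let ?D = "{g \<in> valued_field_hom v1 v2. descends v1 n v2 m g}"
  have \<Phi>: "\<Phi> = (\<lambda>f. THE g. g \<in> valued_field_hom v1 v2 \<and> induced_from v1 n v2 m f g)"
    by (rule ext) (simp only: \<Phi>_def)
  have "bij_betw \<Phi> (hyperfield_hom_over p v1 n v2 m) (valued_field_hom v1 v2) \<longleftrightarrow>
      ?D = valued_field_hom v1 v2"
  proof
    assume "bij_betw \<Phi> (hyperfield_hom_over p v1 n v2 m) (valued_field_hom v1 v2)"
    from bij_betw_imp_surj_on[OF \<Phi>_bij] bij_betw_imp_surj_on[OF this]
    show "?D = valued_field_hom v1 v2" by (rule trans[OF sym])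
  next
    assume "?D = valued_field_hom v1 v2"
    thus "bij_betw \<Phi> (hyperfield_hom_over p v1 n v2 m) (valued_field_hom v1 v2)"
      using \<Phi>_bij by (simp only:)
  qed
  also have "\<dots> \<longleftrightarrow> (\<forall>g\<in>valued_field_hom v1 v2. descends v1 n v2 m g)" by blast
  also have "\<dots> \<longleftrightarrow> m * ramification_index v1 p \<le> n * ramification_index v2 p \<or>
      valued_field_hom v1 v2 = {}"
    using descends_iff by blast
  finally have iff: "bij_betw \<Phi> (hyperfield_hom_over p v1 n v2 m) (valued_field_hom v1 v2) \<longleftrightarrow>
      m * ramification_index v1 p \<le> n * ramification_index v2 p \<or> valued_field_hom v1 v2 = {}" .
  have "\<forall>f\<in>hyperfield_hom_over p v1 n v2 m.
      \<exists>!g. g \<in> valued_field_hom v1 v2 \<and> induced_from v1 n v2 m f g" using ex1_inducing by (rule ballI)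
  thus ?thesis unfolding Let_def \<Phi>[symmetric] by (intro conjI iff \<Phi>_bij)
qed

end
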